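(* A connected graph $G$ satisfies the Bottleneck Property (BP) if and only if there exist constants $\varepsilon>0$ and $k,m\in\mathbb{N}$ (with $k\ge4$ and $k\ge2m$) such that $G$ is $\varepsilon$-densely $(k,m)$-chordal.
   Context: Every edge of the connected graph $G$ has length $1$, interior points of edges are points of $G$, and $d$ is the induced shortest-path (length) metric on $G$, making $G$ a geodesic metric space. A geodesic metric space $(X,d)$ satisfies the Bottleneck Property (BP) if there is a constant $\Delta>0$ such that, given any two distinct points $x,y\in X$ and any midpoint $z$, i.e. $d(x,z)=d(z,y)=\frac12 d(x,y)$, every $xy$-path (path in $X$ joining $x$ to $y$) intersects $N_\Delta(z)=\{w : d(z,w)\le\Delta\}$. Paths are finite and simple. A cycle is a simple closed curve, given by a sequence of vertices all different except that the first and last coincide. $L(\cdot)$ denotes length. For a cycle $C$, $d_C$ denotes the length metric on $C$. A shortcut in $C$ is a path $\sigma$ in $G$ joining two vertices $p,q$ of $C$ with $L(\sigma)<d_C(p,q)$; it is strict if $\sigma\cap C=\{p,q\}$, and then $p,q$ are the shortcut vertices associated to $\sigma$. A subset $A$ of a metric space $(X,\rho)$ is $\varepsilon$-dense if for every $x\in X$ there is $a\in A$ with $\rho(a,x)<\varepsilon$. $G$ is $\varepsilon$-densely $(k,m)$-chordal if for every cycle $C$ with $L(C)\ge k$ there exist strict shortcuts $\sigma_1,\dots,\sigma_r$ in $C$ with $L(\sigma_i)\le m$ for all $i$ whose associated shortcut vertices form an $\varepsilon$-dense subset of $(C,d_C)$. *)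

theory Defs
  imports "HOL-Analysis.Analysis"
begin

section \<open>Graphs, paths and cycles\<close>

text \<open>
  Graphs are simple and undirected, possibly infinite and not necessarily locally finite.  A path is
  given by its sequence of vertices; a cycle by its closed sequence of vertices, in which
  only the first and the last entry coincide.
\<close>

definition ugraph :: "'a set \<Rightarrow> 'a set set \<Rightarrow> bool" where
  "ugraph V E \<longleftrightarrow> (\<forall>e\<in>E. e \<subseteq> V \<and> card e = 2)"

definition walk_edges :: "'a list \<Rightarrow> 'a set set" where
  "walk_edges p = {{p ! i, p ! Suc i} |i. Suc i < length p}"

definition walk_length :: "'a list \<Rightarrow> nat" where
  "walk_length p = length p - 1"

definition vpath :: "'a set \<Rightarrow> 'a set set \<Rightarrow> 'a list \<Rightarrow> bool" where
  "vpath V E p \<longleftrightarrow> p \<noteq> [] \<and> distinct p \<and> set p \<subseteq> V \<and> walk_edges p \<subseteq> E"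

text \<open>Four entries in the closed sequence correspond to a triangle.\<close>

definition vcycle :: "'a set \<Rightarrow> 'a set set \<Rightarrow> 'a list \<Rightarrow> bool" where
  "vcycle V E c \<longleftrightarrow> length c \<ge> 4 \<and> hd c = last c \<and> distinct (tl c) \<and> set c \<subseteq> V \<and> walk_edges c \<subseteq> E"

definition connected_ugraph :: "'a set \<Rightarrow> 'a set set \<Rightarrow> bool" where
  "connected_ugraph V E \<longleftrightarrow>
     ugraph V E \<and> (\<forall>u\<in>V. \<forall>v\<in>V. \<exists>p. vpath V E p \<and> hd p = u \<and> last p = v)"


section \<open>The geodesic metric space of a graph\<close>

text \<open>
  Points are written in barycentric coordinates: \<open>edge_pt u v t\<close> is the point of the edge \<open>{u, v}\<close>
  at distance \<open>t\<close> from \<open>u\<close>, and \<open>edge_pt u v t = edge_pt v u (1 - t)\<close>.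
\<close>

definition vtx :: "'a \<Rightarrow> 'a \<Rightarrow> real" where
  "vtx v = (\<lambda>w. if w = v then 1 else 0)"

definition edge_pt :: "'a \<Rightarrow> 'a \<Rightarrow> real \<Rightarrow> 'a \<Rightarrow> real" where
  "edge_pt u v t = (\<lambda>w. (1 - t) * vtx u w + t * vtx v w)"

definition gpoints :: "'a set \<Rightarrow> 'a set set \<Rightarrow> ('a \<Rightarrow> real) set" where
  "gpoints V E = vtx ` V \<union> {edge_pt u v t |u v t. {u, v} \<in> E \<and> t \<in> {0..1}}"

text \<open>
  \<open>broken_line V E x y l\<close>: some concatenation of finitely many segments, each of them contained in an
  edge, leads from \<open>x\<close> to \<open>y\<close> and has total length \<open>l\<close>.  The length metric in which
  every edge is isometric to the unit interval is the infimum of these lengths.  The value \<open>0\<close> where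
  there is no broken line at all is only a convention: in a connected graph it is taken
  only when \<open>x\<close> or \<open>y\<close> is not a point of the graph.
\<close>

inductive broken_line ::
  "'a set \<Rightarrow> 'a set set \<Rightarrow> ('a \<Rightarrow> real) \<Rightarrow> ('a \<Rightarrow> real) \<Rightarrow> real \<Rightarrow> bool"
  for V :: "'a set" and E :: "'a set set" and x :: "'a \<Rightarrow> real" where
  refl: "x \<in> gpoints V E \<Longrightarrow> broken_line V E x x 0"
| step: "broken_line V E x (edge_pt u v s) l \<Longrightarrow> {u, v} \<in> E \<Longrightarrow> s \<in> {0..1} \<Longrightarrow> t \<in> {0..1} \<Longrightarrow>
     broken_line V E x (edge_pt u v t) (l + \<bar>t - s\<bar>)"

definition gdist :: "'a set \<Rightarrow> 'a set set \<Rightarrow> ('a \<Rightarrow> real) \<Rightarrow> ('a \<Rightarrow> real) \<Rightarrow> real" where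
  "gdist V E x y = (if \<exists>l. broken_line V E x y l then Inf {l. broken_line V E x y l} else 0)"


section \<open>Bottleneck Property\<close>

text \<open>
  The parameters are the carrier and the distance function of a metric space; as everywhere
  here, paths are simple.
\<close>

definition simple_path_from_to ::
  "'p set \<Rightarrow> ('p \<Rightarrow> 'p \<Rightarrow> real) \<Rightarrow> 'p \<Rightarrow> 'p \<Rightarrow> (real \<Rightarrow> 'p) \<Rightarrow> bool" where
  "simple_path_from_to X d x y g \<longleftrightarrow>
     pathin (Metric_space.mtopology X d) g \<and> inj_on g {0..1} \<and> g 0 = x \<and> g 1 = y"

definition bottleneck_property :: "'p set \<Rightarrow> ('p \<Rightarrow> 'p \<Rightarrow> real) \<Rightarrow> bool" where
  "bottleneck_property X d \<longleftrightarrow>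
     (\<exists>\<Delta>>0. \<forall>x\<in>X. \<forall>y\<in>X. \<forall>z\<in>X.
        x \<noteq> y \<and> d x z = d x y / 2 \<and> d z y = d x y / 2 \<longrightarrow>
        (\<forall>g. simple_path_from_to X d x y g \<longrightarrow>
             g ` {0..1} \<inter> Metric_space.mcball X d z \<Delta> \<noteq> {}))"


section \<open>Dense chordality\<close>

text \<open>A path or cycle is also a graph in its own right, so it has a set of points and a length metric.\<close>

definition walk_points :: "'a list \<Rightarrow> ('a \<Rightarrow> real) set" where
  "walk_points p = gpoints (set p) (walk_edges p)"

definition walk_dist :: "'a list \<Rightarrow> ('a \<Rightarrow> real) \<Rightarrow> ('a \<Rightarrow> real) \<Rightarrow> real" where
  "walk_dist p = gdist (set p) (walk_edges p)"

definition shortcut :: "'a set \<Rightarrow> 'a set set \<Rightarrow> 'a list \<Rightarrow> 'a list \<Rightarrow> bool" where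
  "shortcut V E c \<sigma> \<longleftrightarrow>
     vpath V E \<sigma> \<and> hd \<sigma> \<in> set c \<and> last \<sigma> \<in> set c \<and>
     real (walk_length \<sigma>) < walk_dist c (vtx (hd \<sigma>)) (vtx (last \<sigma>))"

definition strict_shortcut :: "'a set \<Rightarrow> 'a set set \<Rightarrow> 'a list \<Rightarrow> 'a list \<Rightarrow> bool" where
  "strict_shortcut V E c \<sigma> \<longleftrightarrow>
     shortcut V E c \<sigma> \<and> walk_points \<sigma> \<inter> walk_points c = {vtx (hd \<sigma>), vtx (last \<sigma>)}"

definition shortcut_vertices :: "'a list \<Rightarrow> 'a set" where
  "shortcut_vertices \<sigma> = {hd \<sigma>, last \<sigma>}"

definition eps_dense :: "real \<Rightarrow> 'p set \<Rightarrow> ('p \<Rightarrow> 'p \<Rightarrow> real) \<Rightarrow> 'p set \<Rightarrow> bool" where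
  "eps_dense \<epsilon> X \<rho> A \<longleftrightarrow> A \<subseteq> X \<and> (\<forall>x\<in>X. \<exists>a\<in>A. \<rho> a x < \<epsilon>)"

definition densely_chordal :: "'a set \<Rightarrow> 'a set set \<Rightarrow> real \<Rightarrow> nat \<Rightarrow> nat \<Rightarrow> bool" where
  "densely_chordal V E \<epsilon> k m \<longleftrightarrow>
     (\<forall>c. vcycle V E c \<and> walk_length c \<ge> k \<longrightarrow>
        (\<exists>\<sigma>s. (\<forall>\<sigma>\<in>set \<sigma>s. strict_shortcut V E c \<sigma> \<and> walk_length \<sigma> \<le> m) \<and>
              eps_dense \<epsilon> (walk_points c) (walk_dist c) (vtx ` (\<Union>\<sigma>\<in>set \<sigma>s. shortcut_vertices \<sigma>))))"


section \<open>The distance of a connected graph is a metric\<close>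

text \<open>
  \<^const>\<open>Metric_space.mtopology\<close> and \<^const>\<open>Metric_space.mcball\<close> above have their intended
  meaning only for metric spaces; this is the justification for the spaces considered here.
\<close>

lemma edge_pt_0 [simp]: "edge_pt u v 0 = vtx u"
  and edge_pt_1 [simp]: "edge_pt u v 1 = vtx v"
  by (auto simp: edge_pt_def)

lemma edge_pt_in_gpoints: "{u, v} \<in> E \<Longrightarrow> t \<in> {0..1} \<Longrightarrow> edge_pt u v t \<in> gpoints V E"
  unfolding gpoints_def by blast

lemma broken_line_nonneg: "broken_line V E x y l \<Longrightarrow> l \<ge> 0"
  by (induction rule: broken_line.induct) auto

lemma broken_line_in_gpoints:
  assumes "broken_line V E x y l"
  shows "x \<in> gpoints V E" "y \<in> gpoints V E"
  using assms by (induction rule: broken_line.induct) (auto intro: edge_pt_in_gpoints)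

lemma broken_line_trans:
  assumes "broken_line V E y z l'" "broken_line V E x y l"
  shows "broken_line V E x z (l + l')"
  using assms
proof (induction rule: broken_line.induct)
  case (step u v s l' t)
  show ?case
    using broken_line.step[OF step.IH[OF step.prems] step.hyps(2-4)] by (simp add: add.assoc)
qed simp

lemma broken_line_edge:
  assumes "{u, v} \<in> E" "s \<in> {0..1}" "t \<in> {0..1}"
  shows "broken_line V E (edge_pt u v s) (edge_pt u v t) \<bar>t - s\<bar>"
  using broken_line.step[OF broken_line.refl[OF edge_pt_in_gpoints] assms] assms by simp

lemma broken_line_sym: "broken_line V E x y l \<Longrightarrow> broken_line V E y x l"
proof (induction rule: broken_line.induct)
  case (step u v s l t)
  have "broken_line V E (edge_pt u v t) (edge_pt u v s) \<bar>s - t\<bar>"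
    using step.hyps by (intro broken_line_edge)
  from broken_line_trans[OF step.IH this] show ?case
    by (simp add: add.commute abs_minus_commute)
qed (rule broken_line.refl)

lemma broken_line_coord: "broken_line V E x y l \<Longrightarrow> \<bar>x w - y w\<bar> \<le> l"
proof (induction rule: broken_line.induct)
  case (step u v s l t)
  have "edge_pt u v s w - edge_pt u v t w = (t - s) * (vtx u w - vtx v w)"
    by (simp add: edge_pt_def algebra_simps)
  moreover have "\<bar>vtx u w - vtx v w\<bar> \<le> 1"
    by (simp add: vtx_def)
  ultimately have "\<bar>edge_pt u v s w - edge_pt u v t w\<bar> \<le> \<bar>t - s\<bar>"
    by (simp add: abs_mult mult_left_le)
  with step.IH show ?case by linarith
qed simp

lemma broken_line_vpath:
  assumes "p \<noteq> []" "set p \<subseteq> V" "walk_edges p \<subseteq> E"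
  shows "\<exists>l. broken_line V E (vtx (hd p)) (vtx (last p)) l"
  using assms
proof (induction p rule: rev_nonempty_induct)
  case (single a)
  then show ?case by (auto intro!: exI broken_line.refl simp: gpoints_def)
next
  case (snoc a p)
  have "walk_edges p \<subseteq> walk_edges (p @ [a])"
  proof
    fix e assume "e \<in> walk_edges p"
    then obtain i where i: "Suc i < length p" "e = {p ! i, p ! Suc i}"
      unfolding walk_edges_def by blast
    then have "Suc i < length (p @ [a])" "e = {(p @ [a]) ! i, (p @ [a]) ! Suc i}"
      by (auto simp: nth_append)
    then show "e \<in> walk_edges (p @ [a])" unfolding walk_edges_def by blast
  qed
  then obtain l where l: "broken_line V E (vtx (hd p)) (vtx (last p)) l"
    using snoc by auto
  have "{last p, a} \<in> walk_edges (p @ [a])"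
    unfolding walk_edges_def using snoc.hyps
    by (auto intro!: exI[of _ "length p - 1"] simp: nth_append last_conv_nth)
  then have e: "{last p, a} \<in> E" using snoc.prems by blast
  have "broken_line V E (vtx (last p)) (vtx a) 1"
    using broken_line_edge[OF e, of 0 1] by simp
  from broken_line_trans[OF this l] show ?case using snoc.hyps by auto
qed

lemma broken_line_to_vertex:
  assumes "ugraph V E" "x \<in> gpoints V E"
  shows "\<exists>v\<in>V. \<exists>l. broken_line V E x (vtx v) l"
proof -
  consider v where "v \<in> V" "x = vtx v"
    | u v t where "{u, v} \<in> E" "t \<in> {0..1}" "x = edge_pt u v t"
    using assms(2) unfolding gpoints_def by blast
  then show ?thesis
  proof cases
    case 1
    then show ?thesis using assms(2) by (blast intro: broken_line.refl)
  next
    case 2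
    then have "v \<in> V" using assms(1) by (auto simp: ugraph_def)
    moreover have "broken_line V E x (vtx v) \<bar>1 - t\<bar>"
      using broken_line_edge[OF 2(1,2), of 1] 2(3) by simp
    ultimately show ?thesis by blast
  qed
qed

lemma broken_line_exists:
  assumes "connected_ugraph V E" "x \<in> gpoints V E" "y \<in> gpoints V E"
  shows "\<exists>l. broken_line V E x y l"
proof -
  have G: "ugraph V E" using assms(1) by (simp add: connected_ugraph_def)
  obtain u l1 where u: "u \<in> V" "broken_line V E x (vtx u) l1"
    using broken_line_to_vertex[OF G assms(2)] by blast
  obtain v l2 where v: "v \<in> V" "broken_line V E y (vtx v) l2"
    using broken_line_to_vertex[OF G assms(3)] by blast
  obtain p where "vpath V E p" "hd p = u" "last p = v"
    using assms(1) u v unfolding connected_ugraph_def by blast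
  then obtain l where "broken_line V E (vtx u) (vtx v) l"
    using broken_line_vpath[of p V E] unfolding vpath_def by auto
  then show ?thesis
    using broken_line_trans[OF broken_line_sym[OF v(2)]] broken_line_trans u(2) by blast
qed

lemma gdist_le: "broken_line V E x y l \<Longrightarrow> gdist V E x y \<le> l"
  unfolding gdist_def
  by (auto intro!: cInf_lower bdd_belowI[of _ 0] broken_line_nonneg)

lemma gdist_greatest:
  assumes "connected_ugraph V E" "x \<in> gpoints V E" "y \<in> gpoints V E"
    and "\<And>l. broken_line V E x y l \<Longrightarrow> b \<le> l"
  shows "b \<le> gdist V E x y"
  unfolding gdist_def
  using broken_line_exists[OF assms(1-3)] assms(4) by (auto intro!: cInf_greatest)

theorem Metric_space_gdist:
  assumes G: "connected_ugraph V E"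
  shows "Metric_space (gpoints V E) (gdist V E)"
proof
  fix x y
  show "gdist V E x y = gdist V E y x"
  proof -
    have "broken_line V E x y = broken_line V E y x"
      using broken_line_sym by (intro ext iffI)
    then show ?thesis unfolding gdist_def by auto
  qed
  show "0 \<le> gdist V E x y"
  proof (cases "\<exists>l. broken_line V E x y l")
    case True
    then show ?thesis
      using gdist_greatest[OF G] broken_line_in_gpoints broken_line_nonneg by meson
  next
    case False
    then show ?thesis unfolding gdist_def by auto
  qed
next
  fix x y assume xy: "x \<in> gpoints V E" "y \<in> gpoints V E"
  show "gdist V E x y = 0 \<longleftrightarrow> x = y"
  proof
    assume 0: "gdist V E x y = 0"
    have "\<bar>x w - y w\<bar> \<le> gdist V E x y" for w
      by (rule gdist_greatest[OF G xy]) (rule broken_line_coord)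
    with 0 show "x = y" by (auto simp: fun_eq_iff)
  next
    assume "x = y"
    then have "broken_line V E x y 0" using xy by (auto intro: broken_line.refl)
    from gdist_le[OF this] gdist_greatest[OF G xy, of 0] show "gdist V E x y = 0"
      using broken_line_nonneg by force
  qed
next
  fix x y z assume xyz: "x \<in> gpoints V E" "y \<in> gpoints V E" "z \<in> gpoints V E"
  have "gdist V E x z - l \<le> gdist V E y z" if l: "broken_line V E x y l" for l
    using gdist_greatest[OF G xyz(2,3), of "gdist V E x z - l"]
      gdist_le[OF broken_line_trans[OF _ l]] by (simp add: algebra_simps)
  then have "gdist V E x z - gdist V E y z \<le> gdist V E x y"
    by (intro gdist_greatest[OF G xyz(1,2)]) (simp add: algebra_simps)
  then show "gdist V E x z \<le> gdist V E x y + gdist V E y z" by simp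
qed

end

theory Submission
  imports Defs
begin

text \<open>
  Both directions compare a geodesic with a detour around its middle.

  From the Bottleneck Property to shortcuts: let \<open>p\<close> be a vertex of a long cycle \<open>C\<close>, and let \<open>a\<close>, \<open>b\<close>
  be the vertices of \<open>C\<close> at distance \<open>N\<close> along \<open>C\<close> on either side of \<open>p\<close>, with \<open>N\<close> larger than the
  bottleneck constant.  Either \<open>a\<close> and \<open>b\<close> are closer in the graph than along \<open>C\<close>, or the arc through
  \<open>p\<close> is a geodesic with midpoint \<open>p\<close>; in the second case the complementary arc is a path from \<open>b\<close> to
  \<open>a\<close>, so it comes close to \<open>p\<close>, although all of it is far from \<open>p\<close> along \<open>C\<close>.  In both cases two
  vertices of \<open>C\<close> near \<open>p\<close> are closer in the graph than in \<open>C\<close>.  A geodesic between two such vertices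
  is cut into pieces by its visits to \<open>C\<close>, and the first point where it has gained on \<open>C\<close> ends a piece
  that is a strict shortcut (\<open>strict_shortcut_near\<close>).

  From shortcuts to the Bottleneck Property: suppose a path between the ends of a geodesic avoids a
  large ball around the midpoint.  By connectedness of the unit interval it can be replaced by a walk
  that avoids a slightly smaller ball (\<open>path_far_adj\<close>).  A shortest walk that avoids this ball and leads
  from the part of the geodesic on one side of the ball to the part on the other side
  closes up with the geodesic segment between its ends to a long cycle (\<open>far_detour_cycle\<close>).  A short
  shortcut of this cycle with an end near the middle of the geodesic cannot reach the detour, so
  both of its ends lie on the geodesic; but no path is shorter than a geodesic.

  To make such arguments precise, distances between vertices are bounded from above by walks and
  from below by potentials (\<open>potential_le_D\<close>); in particular they are attained by walks.
\<close>

section \<open>Distances in a connected graph\<close>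

definition adj :: "'a set set \<Rightarrow> ('a \<times> 'a) set" where
  "adj E = {(u, v). {u, v} \<in> E}"

definition edge_walk :: "'a set set \<Rightarrow> (nat \<Rightarrow> 'a) \<Rightarrow> nat \<Rightarrow> bool" where
  "edge_walk E f n \<longleftrightarrow> (\<forall>i<n. {f i, f (Suc i)} \<in> E)"

text \<open>The piecewise linear curve that passes through \<open>f i\<close> at the time \<open>i\<close>.\<close>

definition walk_pt :: "(nat \<Rightarrow> 'a) \<Rightarrow> real \<Rightarrow> 'a \<Rightarrow> real" where
  "walk_pt f t = edge_pt (f (nat \<lfloor>t\<rfloor>)) (f (Suc (nat \<lfloor>t\<rfloor>))) (frac t)"

lemma edge_pt_swap: "edge_pt u v t = edge_pt v u (1 - t)"
  by (auto simp: edge_pt_def)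

lemma vtx_inject [simp]: "vtx u = vtx v \<longleftrightarrow> u = v"
  by (auto simp: vtx_def fun_eq_iff split: if_splits)

lemma relpow_adj_iff:
  "(u, v) \<in> adj E ^^ n \<longleftrightarrow> (\<exists>f. f 0 = u \<and> f n = v \<and> edge_walk E f n)"
  unfolding relpow_fun_conv edge_walk_def adj_def by simp

lemma walk_pt_cell:
  assumes "real i \<le> t" "t \<le> real i + 1"
  shows "walk_pt f t = edge_pt (f i) (f (Suc i)) (t - real i)"
proof (cases "t = real i + 1")
  case True
  have e: "nat \<lfloor>real i + 1\<rfloor> = Suc i" by linarith
  have "walk_pt f t = vtx (f (Suc i))"
    unfolding walk_pt_def True e by (simp add: frac_def)
  then show ?thesis using True by simp
next
  case False
  then have "\<lfloor>t\<rfloor> = int i" using assms by (intro floor_unique) auto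
  then show ?thesis by (simp add: walk_pt_def frac_def)
qed

lemma walk_pt_nat [simp]: "walk_pt f (real i) = vtx (f i)"
  using walk_pt_cell[of i "real i" f] by simp

lemma real_in_cell:
  assumes "0 \<le> t" "t \<le> real n" "0 < n"
  obtains i where "i < n" "real i \<le> t" "t \<le> real i + 1"
proof (cases "t = real n")
  case True
  then show ?thesis using that[of "n - 1"] assms by (simp add: of_nat_diff)
next
  case False
  have "nat \<lfloor>t\<rfloor> < n" using assms False by linarith
  moreover have "real (nat \<lfloor>t\<rfloor>) \<le> t" "t \<le> real (nat \<lfloor>t\<rfloor>) + 1" using assms by linarith+
  ultimately show ?thesis using that by blast
qed

text \<open>
  The coordinates of a point on the walk determine its parameter, as the barycentre of the
  indices; hence a walk without repeated vertices is traversed injectively.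
\<close>

lemma inj_on_walk_pt:
  assumes inj: "inj_on f {..n}"
  shows "inj_on (walk_pt f) {0..real n}"
proof (cases "n = 0")
  case False
  define \<psi> where "\<psi> x = (\<Sum>j\<le>n. real j * x (f j))" for x :: "'a \<Rightarrow> real"
  have "\<psi> (walk_pt f t) = t" if t: "t \<in> {0..real n}" for t
  proof -
    from t False obtain i where i: "i < n" "real i \<le> t" "t \<le> real i + 1"
      using real_in_cell[of t n] by auto
    have "vtx (f i) (f j) = (if j = i then 1 else 0)"
         "vtx (f (Suc i)) (f j) = (if j = Suc i then 1 else 0)" if "j \<le> n" for j
      using that i inj by (auto simp: vtx_def inj_on_def)
    then have "\<psi> (walk_pt f t) = (\<Sum>j\<le>n. (if j = i then real i * (1 - (t - real i)) else 0)
                 + (if j = Suc i then real (Suc i) * (t - real i) else 0))"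
      unfolding \<psi>_def walk_pt_cell[OF i(2,3)] edge_pt_def by (intro sum.cong) auto
    also have "\<dots> = real i * (1 - (t - real i)) + real (Suc i) * (t - real i)"
      using i by (simp add: sum.distrib)
    finally show ?thesis by (simp add: algebra_simps)
  qed
  then show ?thesis by (metis inj_onI)
qed auto

text \<open>
  Two different edges have at most a vertex in common: a point with two positive coordinates
  determines its edge.
\<close>

lemma edge_pt_eq_cases:
  assumes eq: "edge_pt u v s = edge_pt u' v' s'" and "u \<noteq> v" "u' \<noteq> v'"
  shows "{u, v} = {u', v'} \<or> s \<in> {0, 1} \<and> s' \<in> {0, 1}"
proof -
  have *: "(1 - s) * vtx u w + s * vtx v w = (1 - s') * vtx u' w + s' * vtx v' w" for w
    using fun_cong[OF eq, of w] by (simp add: edge_pt_def)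
  show ?thesis
    using *[of u] *[of v] *[of u'] *[of v'] assms(2,3)
    by (auto simp: vtx_def split: if_splits)
qed

locale connected_graph =
  fixes V :: "'a set" and E :: "'a set set"
  assumes conn: "connected_ugraph V E"
begin

sublocale Metric_space "gpoints V E" "gdist V E"
  using conn by (rule Metric_space_gdist)

abbreviation "D \<equiv> gdist V E"
abbreviation "X \<equiv> gpoints V E"

lemma edge_vertices: "{u, v} \<in> E \<Longrightarrow> u \<in> V" "{u, v} \<in> E \<Longrightarrow> v \<in> V" "{u, v} \<in> E \<Longrightarrow> u \<noteq> v"
  using conn unfolding connected_ugraph_def ugraph_def by fastforce+

lemma vtx_in [simp]: "v \<in> V \<Longrightarrow> vtx v \<in> X"
  by (simp add: gpoints_def)

lemma points_cases [consumes 1, case_names vertex edge]: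
  assumes "x \<in> X"
  obtains v where "v \<in> V" "x = vtx v"
    | u v t where "{u, v} \<in> E" "0 \<le> t" "t \<le> 1" "x = edge_pt u v t"
  using assms unfolding gpoints_def by auto

lemma D_edge:
  assumes "{u, v} \<in> E" "0 \<le> s" "s \<le> 1" "0 \<le> t" "t \<le> 1"
  shows "D (edge_pt u v s) (edge_pt u v t) \<le> \<bar>t - s\<bar>"
  using assms by (intro gdist_le broken_line_edge) auto

lemma near_vertex:
  assumes "x \<in> X"
  obtains v where "v \<in> V" "D x (vtx v) \<le> 1"
  using assms
proof (cases x rule: points_cases)
  case (vertex v)
  then show ?thesis using that[of v] by (simp add: mdist_zero)
next
  case (edge u v t)
  then show ?thesis using that[of v] D_edge[of u v t 1] edge_vertices by simp
qed

text \<open>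
  Lower bounds for distances: a function on the vertices that changes by at most one along every
  edge extends affinely over the edges, and the extension is 1-Lipschitz.
\<close>

lemma potential_le_D:
  assumes lip: "\<And>u v. {u, v} \<in> E \<Longrightarrow> \<bar>\<phi> u - \<phi> v\<bar> \<le> (1::real)" and "u \<in> V" "v \<in> V"
  shows "\<bar>\<phi> u - \<phi> v\<bar> \<le> D (vtx u) (vtx v)"
proof -
  define F where "F x = (\<Sum>w | x w \<noteq> 0. x w * \<phi> w)" for x :: "'a \<Rightarrow> real"
  have F_edge: "F (edge_pt a b t) = (1 - t) * \<phi> a + t * \<phi> b" if "a \<noteq> b" for a b t
  proof -
    have "F (edge_pt a b t) = (\<Sum>w\<in>{a, b}. edge_pt a b t w * \<phi> w)"
      unfolding F_def by (intro sum.mono_neutral_left) (auto simp: edge_pt_def vtx_def split: if_splits)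
    then show ?thesis using that by (simp add: edge_pt_def vtx_def)
  qed
  have F_vtx: "F (vtx a) = \<phi> a" for a
  proof -
    have "{w. vtx a w \<noteq> 0} = {a}" by (auto simp: vtx_def)
    then show ?thesis by (simp add: F_def vtx_def)
  qed
  have "\<bar>F x - F y\<bar> \<le> l" if "broken_line V E x y l" for x y l
    using that
  proof (induction rule: broken_line.induct)
    case (step a b s l t)
    have "F (edge_pt a b s) - F (edge_pt a b t) = (t - s) * (\<phi> a - \<phi> b)"
      using edge_vertices(3)[OF step.hyps(2)] by (simp add: F_edge algebra_simps)
    then have "\<bar>F (edge_pt a b s) - F (edge_pt a b t)\<bar> \<le> \<bar>t - s\<bar>"
      using lip[OF step.hyps(2)] by (simp add: abs_mult mult_left_le)
    with step.IH show ?case by linarith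
  qed simp
  then have "\<bar>F (vtx u) - F (vtx v)\<bar> \<le> D (vtx u) (vtx v)"
    using assms(2,3) by (intro gdist_greatest[OF conn]) auto
  then show ?thesis by (simp add: F_vtx)
qed

lemma edge_walk_in:
  assumes "edge_walk E f n" "f 0 \<in> V" "i \<le> n"
  shows "f i \<in> V"
proof (cases i)
  case (Suc j)
  then show ?thesis using assms edge_vertices(2)[of "f j" "f i"] by (auto simp: edge_walk_def)
qed (use assms in simp)

lemma walk_pt_in:
  assumes "edge_walk E f n" "f 0 \<in> V" "0 \<le> t" "t \<le> real n"
  shows "walk_pt f t \<in> X"
proof (cases "n = 0")
  case True
  then show ?thesis using assms walk_pt_nat[of f 0] by simp
next
  case False
  then obtain i where i: "i < n" "real i \<le> t" "t \<le> real i + 1"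
    using real_in_cell[OF assms(3,4)] by blast
  then show ?thesis unfolding walk_pt_cell[OF i(2,3)]
    using assms(1) by (intro edge_pt_in_gpoints) (auto simp: edge_walk_def)
qed

lemma D_walk_pt:
  assumes w: "edge_walk E f n" "f 0 \<in> V" and "0 \<le> s" "s \<le> real n" "0 \<le> t" "t \<le> real n"
  shows "D (walk_pt f s) (walk_pt f t) \<le> \<bar>s - t\<bar>"
proof -
  have cell: "D (walk_pt f s) (walk_pt f t) \<le> t - s"
    if "i < n" "real i \<le> s" "s \<le> t" "t \<le> real i + 1" for i s t
    using D_edge[of "f i" "f (Suc i)" "s - real i" "t - real i"] that w
    by (simp add: walk_pt_cell[of i] edge_walk_def)
  have main: "D (walk_pt f s) (walk_pt f t) \<le> t - s"
    if "0 \<le> s" "s \<le> t" "t \<le> real m" "m \<le> n" for m s t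
    using that
  proof (induction m arbitrary: s t)
    case 0
    then have "s = 0" "t = 0" by auto
    then show ?case using w walk_pt_in[OF w, of 0] by (simp add: mdist_zero)
  next
    case (Suc m)
    consider "t \<le> real m" | "real m \<le> s" | "s < real m" "real m < t" by linarith
    then show ?case
    proof cases
      case 3
      have "D (walk_pt f s) (walk_pt f t)
          \<le> D (walk_pt f s) (walk_pt f (real m)) + D (walk_pt f (real m)) (walk_pt f t)"
        using Suc.prems 3 by (intro triangle walk_pt_in[OF w]) auto
      also have "\<dots> \<le> (real m - s) + (t - real m)"
        using Suc.prems 3 by (intro add_mono[OF Suc.IH cell[of m]]) auto
      finally show ?thesis by simp
    qed (use Suc cell[of m s t] in auto)
  qed
  show ?thesis
    using main[of s t n] main[of t s n] assms by (cases "s \<le> t") (auto simp: commute)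
qed

lemma D_edge_walk:
  assumes "edge_walk E f n" "f 0 \<in> V" "i \<le> n" "j \<le> n"
  shows "D (vtx (f i)) (vtx (f j)) \<le> \<bar>real i - real j\<bar>"
  using D_walk_pt[OF assms(1,2), of "real i" "real j"] assms(3,4) by simp

lemma walk_exists:
  assumes "u \<in> V" "v \<in> V"
  shows "\<exists>n. (u, v) \<in> adj E ^^ n"
proof -
  obtain p where p: "vpath V E p" "hd p = u" "last p = v"
    using conn assms unfolding connected_ugraph_def by blast
  then have "edge_walk E ((!) p) (length p - 1)"
    unfolding vpath_def edge_walk_def walk_edges_def by fastforce
  moreover have "p ! 0 = u" "p ! (length p - 1) = v"
    using p by (auto simp: vpath_def hd_conv_nth last_conv_nth)
  ultimately show ?thesis unfolding relpow_adj_iff by blast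
qed

text \<open>
  The number of edges of a shortest walk from a fixed vertex is a potential, so no broken line is
  shorter than a shortest walk: distances between vertices are attained by walks.
\<close>

lemma D_eq_shortest_walk:
  assumes uv: "u \<in> V" "v \<in> V"
  shows "\<exists>n. (u, v) \<in> adj E ^^ n \<and> D (vtx u) (vtx v) = real n"
proof -
  define h where "h w = (LEAST n. (u, w) \<in> adj E ^^ n)" for w
  have h: "(u, w) \<in> adj E ^^ h w" if "w \<in> V" for w
    unfolding h_def using walk_exists[OF uv(1) that] by (rule LeastI_ex)
  have h_step: "h b \<le> Suc (h a)" if "{a, b} \<in> E" for a b
  proof -
    have "(a, b) \<in> adj E" using that by (simp add: adj_def)
    then have "(u, b) \<in> adj E ^^ Suc (h a)"
      using h[OF edge_vertices(1)[OF that]] by auto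
    then show ?thesis unfolding h_def by (rule Least_le)
  qed
  have "h u = 0" unfolding h_def by (rule Least_equality) auto
  then have "real (h v) \<le> D (vtx u) (vtx v)"
    using potential_le_D[of "\<lambda>w. real (h w)", OF _ uv] h_step
    by (smt (verit) insert_commute of_nat_0 of_nat_Suc of_nat_mono)
  moreover have "D (vtx u) (vtx v) \<le> real (h v)"
    using h[OF uv(2)] uv D_edge_walk[of _ "h v" 0 "h v"] unfolding relpow_adj_iff by fastforce
  ultimately show ?thesis using h[OF uv(2)] by (intro exI[of _ "h v"]) simp
qed

text \<open>
  The triangle inequality leaves no slack: if the whole walk is as long as the distance of its ends,
  then so is each of its parts.
\<close>

lemma isometric_shortest_walk:
  assumes f: "edge_walk E f n" "f 0 \<in> V" "D (vtx (f 0)) (vtx (f n)) = real n"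
    and ij: "i \<le> n" "j \<le> n"
  shows "D (vtx (f i)) (vtx (f j)) = \<bar>real i - real j\<bar>"
proof -
  have in_X: "vtx (f i) \<in> X" if "i \<le> n" for i
    using edge_walk_in[OF f(1,2) that] by simp
  have le: "real j - real i \<le> D (vtx (f i)) (vtx (f j))" if "i \<le> n" "j \<le> n" for i j
  proof -
    have "D (vtx (f 0)) (vtx (f n)) \<le> D (vtx (f 0)) (vtx (f i)) + D (vtx (f i)) (vtx (f n))"
      using that by (intro triangle in_X) auto
    moreover have "D (vtx (f i)) (vtx (f n)) \<le> D (vtx (f i)) (vtx (f j)) + D (vtx (f j)) (vtx (f n))"
      using that by (intro triangle in_X) auto
    moreover have "D (vtx (f 0)) (vtx (f i)) \<le> real i" "D (vtx (f j)) (vtx (f n)) \<le> real n - real j"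
      using D_edge_walk[OF f(1,2), of 0 i] D_edge_walk[OF f(1,2), of j n] that by auto
    ultimately show ?thesis using f(3) by linarith
  qed
  show ?thesis
    using D_edge_walk[OF f(1,2) ij] le[OF ij] le[OF ij(2,1)] commute[of "vtx (f i)" "vtx (f j)"]
    by linarith
qed

text \<open>
  A broken line that leaves the edge of its starting point has to pass through an end of this edge,
  so a geodesic to a point off this edge can be chosen through a vertex next to its start.
\<close>

lemma exit_vertex:
  assumes x: "x \<in> X" and z: "z \<in> X" and far: "D x z > 1"
  obtains a where "a \<in> V" "D x (vtx a) \<le> 1" "D x z = D x (vtx a) + D (vtx a) z"
  using x
proof (cases x rule: points_cases)
  case (vertex v)
  then show ?thesis using that[of v] by (simp add: mdist_zero)
next
  case (edge u v s)
  have uv: "u \<in> V" "v \<in> V" "u \<noteq> v" using edge_vertices[OF edge(1)] by auto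
  have Dx: "D x (edge_pt u v t) \<le> \<bar>t - s\<bar>" if "t \<in> {0..1}" for t
    using D_edge[OF edge(1), of s t] that edge by simp
  have exit: "(\<exists>t\<in>{0..1}. y = edge_pt u v t \<and> \<bar>t - s\<bar> \<le> l) \<or>
      (\<exists>a\<in>{u, v}. D x (vtx a) + D (vtx a) y \<le> l)" if "broken_line V E x y l" for y l
    using that
  proof (induction rule: broken_line.induct)
    case refl
    then show ?case using edge by (intro disjI1 bexI[of _ s]) auto
  next
    case (step u' v' s' l t')
    let ?y = "edge_pt u' v' s'" and ?y' = "edge_pt u' v' t'"
    have yX: "?y \<in> X" "?y' \<in> X" using step.hyps by (auto intro: edge_pt_in_gpoints)
    have Dy: "D ?y ?y' \<le> \<bar>t' - s'\<bar>" using D_edge[OF step.hyps(2)] step.hyps by simp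
    from step.IH show ?case
    proof
      assume "\<exists>a\<in>{u, v}. D x (vtx a) + D (vtx a) ?y \<le> l"
      then obtain a where a: "a \<in> {u, v}" "D x (vtx a) + D (vtx a) ?y \<le> l" by blast
      then have "D (vtx a) ?y' \<le> D (vtx a) ?y + D ?y ?y'"
        using yX uv by (intro triangle) auto
      with a Dy show ?thesis by (intro disjI2 bexI[of _ a]) auto
    next
      assume "\<exists>t\<in>{0..1}. ?y = edge_pt u v t \<and> \<bar>t - s\<bar> \<le> l"
      then obtain t where t: "t \<in> {0..1}" "?y = edge_pt u v t" "\<bar>t - s\<bar> \<le> l" by blast
      from edge_pt_eq_cases[OF t(2) edge_vertices(3)[OF step.hyps(2)] uv(3)]
      consider "u' = u" "v' = v" | "u' = v" "v' = u" | "t \<in> {0, 1}"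
        by (auto simp: doubleton_eq_iff)
      then show ?thesis
      proof cases
        case 1
        then have "s' = t" using fun_cong[OF t(2), of v] uv by (simp add: edge_pt_def vtx_def)
        with 1 t step.hyps show ?thesis by (intro disjI1 bexI[of _ t']) auto
      next
        case 2
        then have "s' = 1 - t" using fun_cong[OF t(2), of u] uv by (simp add: edge_pt_def vtx_def)
        with 2 t step.hyps show ?thesis
          by (intro disjI1 bexI[of _ "1 - t'"]) (auto simp: edge_pt_swap[of v u])
      next
        case 3
        then obtain a where a: "a \<in> {u, v}" "?y = vtx a" using t(2) by auto
        have "D x ?y \<le> l" using Dx[OF t(1)] t by simp
        with a Dy show ?thesis by (intro disjI2 bexI[of _ a]) auto
      qed
    qed
  qed
  have "min (D x (vtx u) + D (vtx u) z) (D x (vtx v) + D (vtx v) z) \<le> D x z"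
  proof (rule gdist_greatest[OF conn x z])
    fix l assume "broken_line V E x z l"
    from exit[OF this]
    show "min (D x (vtx u) + D (vtx u) z) (D x (vtx v) + D (vtx v) z) \<le> l"
    proof
      assume "\<exists>t\<in>{0..1}. z = edge_pt u v t \<and> \<bar>t - s\<bar> \<le> l"
      then obtain t where "t \<in> {0..1}" "z = edge_pt u v t" by blast
      then have "D x z \<le> 1" using Dx[of t] edge by auto
      with far show ?thesis by simp
    qed auto
  qed
  moreover have "D x z \<le> D x (vtx u) + D (vtx u) z" "D x z \<le> D x (vtx v) + D (vtx v) z"
    using x z uv by (auto intro: triangle)
  moreover have "D x (vtx u) \<le> 1" "D x (vtx v) \<le> 1"
    using Dx[of 0] Dx[of 1] edge by auto
  ultimately show ?thesis using that[of u] that[of v] uv by linarith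
qed

text \<open>
  An injective walk is a simple path in the metric sense: its parametrization is Lipschitz, hence
  continuous.
\<close>

lemma simple_path_edge_walk:
  assumes f: "edge_walk E f n" "f 0 \<in> V" and inj: "inj_on f {..n}" and n: "0 < n"
  shows "simple_path_from_to X D (vtx (f 0)) (vtx (f n)) (\<lambda>t. walk_pt f (real n * t))"
proof -
  have range: "real n * t \<in> {0..real n}" if "t \<in> {0..1}" for t
    using that by (auto simp: mult_left_le)
  have "continuous_map (top_of_set {0..1}) mtopology (\<lambda>t. walk_pt f (real n * t))"
    unfolding continuous_map_to_metric
  proof (intro ballI allI impI)
    fix t e :: real assume t: "t \<in> topspace (top_of_set {0..1})" and e: "e > 0"
    let ?U = "{0..1} \<inter> ball t (e / real n)"
    have "walk_pt f (real n * s) \<in> mball (walk_pt f (real n * t)) e" if s: "s \<in> ?U" for s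
    proof -
      have "D (walk_pt f (real n * t)) (walk_pt f (real n * s)) \<le> \<bar>real n * t - real n * s\<bar>"
        using range[of s] range[of t] s t by (intro D_walk_pt[OF f]) auto
      also have "\<dots> = real n * dist t s"
        by (simp add: dist_real_def abs_mult flip: right_diff_distrib)
      also have "\<dots> < e" using s n by (simp add: field_simps)
      finally show ?thesis using range[of s] range[of t] s t walk_pt_in[OF f] by auto
    qed
    moreover have "openin (top_of_set {0..1}) ?U" by (simp add: openin_open_Int)
    moreover have "t \<in> ?U" using t e n by simp
    ultimately show "\<exists>U. openin (top_of_set {0..1}) U \<and> t \<in> U \<and>
        (\<forall>s\<in>U. walk_pt f (real n * s) \<in> mball (walk_pt f (real n * t)) e)"
      by blast
  qed
  moreover have "inj_on (\<lambda>t. walk_pt f (real n * t)) {0..1}"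
    using inj_on_walk_pt[OF inj] range n unfolding inj_on_def by fastforce
  ultimately show ?thesis
    unfolding simple_path_from_to_def pathin_def
    using walk_pt_nat[of f 0] by simp
qed

lemma D_vpath_le:
  assumes "vpath V E p"
  shows "D (vtx (hd p)) (vtx (last p)) \<le> walk_length p"
proof -
  have "edge_walk E ((!) p) (length p - 1)"
    using assms unfolding vpath_def edge_walk_def walk_edges_def by fastforce
  moreover have "p ! 0 = hd p" "p ! (length p - 1) = last p" "p ! 0 \<in> V"
    using assms by (auto simp: vpath_def hd_conv_nth last_conv_nth)
  ultimately show ?thesis
    using D_edge_walk[of "(!) p" "length p - 1" 0 "length p - 1"] by (simp add: walk_length_def)
qed

end

section \<open>Cycles and their shortcuts\<close>

lemma walk_edges_map_upt:
  "walk_edges (map f [i..<Suc j]) = {{f k, f (Suc k)} |k. i \<le> k \<and> k < j}"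
proof -
  have "walk_edges (map f [i..<Suc j]) = {{f (i + k), f (Suc (i + k))} |k. i + k < j}"
    unfolding walk_edges_def
    by (rule Collect_cong, rule ex_cong1) (auto simp: nth_append less_diff_conv simp del: upt_Suc)
  also have "\<dots> = {{f k, f (Suc k)} |k. i \<le> k \<and> k < j}"
    by (auto simp: le_iff_add)
  finally show ?thesis .
qed

lemma gpoints_Int_of_disjoint_edges:
  assumes "ugraph V1 E1" "ugraph V2 E2" "E1 \<inter> E2 = {}"
  shows "gpoints V1 E1 \<inter> gpoints V2 E2 = vtx ` (V1 \<inter> V2)"
proof
  have split: thesis
    if "ugraph V E" "x \<in> gpoints V E" "\<And>v. v \<in> V \<Longrightarrow> x = vtx v \<Longrightarrow> thesis"
      "\<And>u v t. {u, v} \<in> E \<Longrightarrow> u \<noteq> v \<Longrightarrow> t \<notin> {0, 1} \<Longrightarrow> x = edge_pt u v t \<Longrightarrow> thesis"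
    for x :: "'a \<Rightarrow> real" and V E thesis
  proof -
    have uv: "u \<in> V" "v \<in> V" "u \<noteq> v" if "{u, v} \<in> E" for u v
      using \<open>ugraph V E\<close> that unfolding ugraph_def by fastforce+
    from that(2) consider v where "v \<in> V" "x = vtx v" | u v t where "{u, v} \<in> E" "x = edge_pt u v t"
      unfolding gpoints_def by blast
    then show thesis
    proof cases
      case (2 u v t)
      show thesis
      proof (cases "t \<in> {0, 1}")
        case True
        then have "x = vtx u \<or> x = vtx v" using 2 by auto
        then show thesis using that(3) uv[OF 2(1)] by blast
      qed (use that(4) 2 uv in blast)
    qed (use that(3) in blast)
  qed
  have not_vtx: "edge_pt u v t \<noteq> vtx w" if "u \<noteq> v" "t \<notin> {0, 1}" for u v w :: 'a and t
  proof
    assume eq: "edge_pt u v t = vtx w"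
    from fun_cong[OF eq, of u] fun_cong[OF eq, of v] that show False
      by (auto simp: edge_pt_def vtx_def split: if_splits)
  qed
  show "gpoints V1 E1 \<inter> gpoints V2 E2 \<subseteq> vtx ` (V1 \<inter> V2)"
  proof
    fix x assume x: "x \<in> gpoints V1 E1 \<inter> gpoints V2 E2"
    show "x \<in> vtx ` (V1 \<inter> V2)"
    proof (rule split[OF assms(1), of x])
      fix v assume v: "v \<in> V1" "x = vtx v"
      show ?thesis
      proof (rule split[OF assms(2), of x])
        fix w assume "w \<in> V2" "x = vtx w"
        with v show ?thesis by auto
      next
        fix a b t assume "a \<noteq> b" "t \<notin> {0, 1}" "x = edge_pt a b t"
        with v not_vtx show ?thesis by metis
      qed (use x in simp)
    next
      fix u v s assume uv: "{u, v} \<in> E1" "u \<noteq> v" "s \<notin> {0, 1}" "x = edge_pt u v s"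
      show ?thesis
      proof (rule split[OF assms(2), of x])
        fix w assume "x = vtx w"
        with uv not_vtx show ?thesis by metis
      next
        fix a b t assume ab: "{a, b} \<in> E2" "a \<noteq> b" "x = edge_pt a b t"
        then have "{u, v} = {a, b}" using edge_pt_eq_cases[of u v s a b t] uv by auto
        then show ?thesis using ab(1) uv(1) assms(3) by auto
      qed (use x in simp)
    qed (use x in simp)
  qed
qed (auto simp: gpoints_def)

locale cycle_in_graph = connected_graph V E for V :: "'a set" and E +
  fixes c :: "'a list"
  assumes vcyc: "vcycle V E c"
begin

text \<open>
  Indices modulo the length make all rotations of the cycle available: arcs may start at
  any vertex and run past the end of the list.
\<close>

definition L where "L = walk_length c"
definition cyc where "cyc i = c ! (i mod L)"

lemma L_ge: "3 \<le> L" and length_c: "length c = Suc L"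
  using vcyc by (auto simp: vcycle_def L_def walk_length_def)

lemma cyc_nth: "i \<le> L \<Longrightarrow> c ! i = cyc i"
proof (cases "i = L")
  case True
  moreover have "c \<noteq> []" using length_c by auto
  ultimately show ?thesis
    using vcyc length_c hd_conv_nth[of c] last_conv_nth[of c] by (simp add: cyc_def vcycle_def)
qed (simp add: cyc_def)

lemma cyc_eq_iff: "cyc i = cyc j \<longleftrightarrow> i mod L = j mod L"
proof -
  obtain x ys where c: "c = x # ys" using length_c by (cases c) auto
  have ys: "distinct ys" "ys \<noteq> []" "last ys = x" "length ys = L"
    using vcyc length_c L_ge unfolding vcycle_def c by (auto split: if_splits)
  then have "distinct (butlast ys @ [x])" by (metis append_butlast_last_id)
  then have "distinct (butlast c)" using c ys by auto
  moreover have "butlast c ! k = c ! k" if "k < L" for k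
    using that length_c by (simp add: nth_butlast)
  moreover have "i mod L < L" "j mod L < L" using L_ge by auto
  ultimately show ?thesis
    unfolding cyc_def using length_c nth_eq_iff_index_eq[of "butlast c" "i mod L" "j mod L"] by simp
qed

lemma cyc_shift_eq_iff: "r < L \<Longrightarrow> s < L \<Longrightarrow> cyc (i + r) = cyc (i + s) \<longleftrightarrow> r = s"
proof -
  have le: "r = s" if "(i + r) mod L = (i + s) mod L" "r \<le> s" "s < L" for r s
  proof -
    have "L dvd (i + s) - (i + r)"
      using that mod_eq_dvd_iff_nat[of "i + r" "i + s" L] by simp
    then show ?thesis using that by (auto dest: dvd_imp_le)
  qed
  show "r < L \<Longrightarrow> s < L \<Longrightarrow> cyc (i + r) = cyc (i + s) \<longleftrightarrow> r = s"
    unfolding cyc_eq_iff using le[of r s] le[of s r] by (cases "r \<le> s") auto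
qed

lemma cyc_add_L [simp]: "cyc (i + L) = cyc i"
  by (simp add: cyc_def)

lemma set_c: "set c = range cyc"
proof -
  have "set c = (\<lambda>i. c ! i) ` {..L}" using length_c by (auto simp: set_conv_nth)
  also have "\<dots> = cyc ` {..L}" using cyc_nth by auto
  also have "\<dots> = range cyc"
  proof
    show "range cyc \<subseteq> cyc ` {..L}"
    proof
      fix v assume "v \<in> range cyc"
      then obtain i where "v = cyc i" by blast
      then have "v = cyc (i mod L)" by (simp add: cyc_def)
      moreover have "i mod L \<le> L" using L_ge by (simp add: less_imp_le)
      ultimately show "v \<in> cyc ` {..L}" by blast
    qed
  qed auto
  finally show ?thesis .
qed

lemma edges_c: "walk_edges c = {{cyc i, cyc (Suc i)} |i. True}"
proof -
  have "walk_edges c = {{cyc i, cyc (Suc i)} |i. i < L}"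
    unfolding walk_edges_def length_c using cyc_nth by (intro Collect_cong ex_cong1) auto
  also have "\<dots> = {{cyc i, cyc (Suc i)} |i. True}"
  proof (intro Collect_cong iffI; elim exE conjE)
    fix e i assume "e = {cyc i, cyc (Suc i)}"
    then show "\<exists>j. e = {cyc j, cyc (Suc j)} \<and> j < L"
      using L_ge by (intro exI[of _ "i mod L"]) (simp add: cyc_def mod_Suc_eq)
  qed blast
  finally show ?thesis .
qed

lemma c_subset: "set c \<subseteq> V" "walk_edges c \<subseteq> E"
  using vcyc by (auto simp: vcycle_def)

lemma cyc_in [simp]: "cyc i \<in> set c" "cyc i \<in> V"
  using set_c c_subset by auto

lemma edge_walk_cyc: "edge_walk (walk_edges c) (\<lambda>k. cyc (i + k)) n"
  unfolding edge_walk_def edges_c by auto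

lemma ugraph_c: "ugraph (set c) (walk_edges c)"
  using conn c_subset unfolding connected_ugraph_def ugraph_def by (auto simp: edges_c)

lemma shift_exists: "\<exists>r<L. (i + r) mod L = k mod L"
proof -
  define r where "r = nat ((int k - int i) mod int L)"
  have r: "int r = (int k - int i) mod int L" using L_ge by (simp add: r_def)
  then have "int ((i + r) mod L) = int (k mod L)"
    by (simp add: zmod_int mod_simps)
  moreover have "r < L" using L_ge by (simp add: r_def nat_less_iff)
  ultimately show ?thesis by (metis of_nat_eq_iff)
qed

lemma connected_c: "connected_ugraph (set c) (walk_edges c)"
  unfolding connected_ugraph_def
proof (intro conjI ballI ugraph_c)
  fix u v assume "u \<in> set c" "v \<in> set c"
  then obtain i k where "u = cyc i" "v = cyc k" by (auto simp: set_c)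
  moreover obtain r where r: "r < L" "(i + r) mod L = k mod L"
    using shift_exists by blast
  ultimately have uv: "u = cyc i" "v = cyc (i + r)" by (auto simp: cyc_eq_iff)
  let ?p = "map (\<lambda>j. cyc (i + j)) [0..<Suc r]"
  have "walk_edges ?p \<subseteq> walk_edges c" unfolding walk_edges_map_upt edges_c by auto
  moreover have "distinct ?p"
    using r cyc_shift_eq_iff unfolding distinct_map by (auto intro!: inj_onI simp del: upt_Suc)
  moreover have "hd ?p = u" using uv by (simp add: hd_map del: upt_Suc)
  moreover have "last ?p = v" using uv by simp
  moreover have "set ?p \<subseteq> set c" by (auto simp del: upt_Suc)
  moreover have "?p \<noteq> []" by simp
  ultimately show "\<exists>p. vpath (set c) (walk_edges c) p \<and> hd p = u \<and> last p = v"
    unfolding vpath_def by blast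
qed

sublocale C: connected_graph "set c" "walk_edges c"
  by unfold_locales (rule connected_c)

lemma D_le_C:
  assumes "u \<in> set c" "v \<in> set c"
  shows "D (vtx u) (vtx v) \<le> C.D (vtx u) (vtx v)"
proof -
  obtain n f where f: "f 0 = u" "f n = v" "edge_walk (walk_edges c) f n" "C.D (vtx u) (vtx v) = real n"
    using C.D_eq_shortest_walk[OF assms] unfolding relpow_adj_iff by blast
  then have "edge_walk E f n" using c_subset unfolding edge_walk_def by auto
  from D_edge_walk[OF this, of 0 n] show ?thesis using f assms c_subset by auto
qed

lemma C_le: "C.D (vtx (cyc i)) (vtx (cyc (i + r))) \<le> real r"
  using C.D_edge_walk[OF edge_walk_cyc[of i r], of 0 r] by simp

text \<open>The distance to a fixed vertex around the cycle, the shorter way, is a potential on the cycle.\<close>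

lemma C_ge:
  assumes "r \<le> L"
  shows "real (min r (L - r)) \<le> C.D (vtx (cyc i)) (vtx (cyc (i + r)))"
proof -
  define \<phi> where "\<phi> v = (let r = LEAST r. v = cyc (i + r) in real (min r (L - r)))" for v
  have \<phi>: "\<phi> (cyc (i + r)) = real (min r (L - r))" if "r \<le> L" for r
  proof (cases "r = L")
    case True
    have "(LEAST s. cyc (i + r) = cyc (i + s)) = 0"
      using True by (intro Least_equality) auto
    then show ?thesis using True by (simp add: \<phi>_def)
  next
    case False
    have "(LEAST s. cyc (i + r) = cyc (i + s)) = r"
    proof (rule Least_equality)
      fix s assume "cyc (i + r) = cyc (i + s)"
      then show "r \<le> s" using cyc_shift_eq_iff[of r s i] False that by (cases "s < L") auto
    qed simp
    then show ?thesis by (simp add: \<phi>_def)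
  qed
  have "\<bar>\<phi> u - \<phi> v\<bar> \<le> 1" if "{u, v} \<in> walk_edges c" for u v
  proof -
    obtain k where k: "{u, v} = {cyc k, cyc (Suc k)}" using \<open>{u, v} \<in> walk_edges c\<close> by (auto simp: edges_c)
    obtain s where s: "s < L" "(i + s) mod L = k mod L" using shift_exists by blast
    then have "cyc k = cyc (i + s)" "cyc (Suc k) = cyc (i + Suc s)"
      using mod_Suc_eq[of "i + s" L] mod_Suc_eq[of k L] by (simp_all add: cyc_def)
    moreover have "\<bar>\<phi> (cyc (i + s)) - \<phi> (cyc (i + Suc s))\<bar> \<le> 1"
      using s \<phi>[of s] \<phi>[of "Suc s"] by (auto simp: min_def)
    ultimately show ?thesis using k by (auto simp: doubleton_eq_iff)
  qed
  then have "\<bar>\<phi> (cyc i) - \<phi> (cyc (i + r))\<bar> \<le> C.D (vtx (cyc i)) (vtx (cyc (i + r)))"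
    by (intro C.potential_le_D) auto
  then show ?thesis using \<phi>[of 0] \<phi>[OF assms] by simp
qed

text \<open>
  Follow a geodesic \<open>f\<close> from \<open>a\<close> to \<open>b\<close>, and let \<open>f j\<close> be its first vertex on the cycle that it reaches
  faster than the cycle does; since \<open>b\<close> is such a vertex, \<open>f j\<close> exists.  At the last visit \<open>f i\<close> before
  it, nothing has been gained yet.  So the piece between them is shorter than the way along the cycle,
  and it starts at a vertex which is not far from \<open>a\<close> along the cycle either.  It meets the
  cycle only in its ends, since there is no visit in between, and since a piece that consists of one
  edge is not an edge of the cycle, where its ends are further apart.
\<close>

lemma strict_shortcut_near:
  assumes ab: "a \<in> set c" "b \<in> set c" and lt: "D (vtx a) (vtx b) < C.D (vtx a) (vtx b)"
  obtains \<sigma> where "strict_shortcut V E c \<sigma>" "walk_length \<sigma> \<le> D (vtx a) (vtx b)"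
    "C.D (vtx a) (vtx (hd \<sigma>)) \<le> D (vtx a) (vtx b)"
proof -
  have abV: "a \<in> V" "b \<in> V" using ab c_subset by auto
  obtain n f where f: "f 0 = a" "f n = b" "edge_walk E f n" and n: "D (vtx a) (vtx b) = real n"
    using D_eq_shortest_walk[OF abV] unfolding relpow_adj_iff by blast
  have iso: "D (vtx (f i)) (vtx (f j)) = \<bar>real i - real j\<bar>" if "i \<le> n" "j \<le> n" for i j
    using isometric_shortest_walk[OF f(3)] f abV n that by simp
  have fV: "f i \<in> V" if "i \<le> n" for i using edge_walk_in[OF f(3)] f abV that by simp
  have inj: "i = j" if "f i = f j" "i \<le> n" "j \<le> n" for i j
    using iso[of i j] iso[of i i] that by simp
  define P where "P j \<longleftrightarrow> j \<le> n \<and> f j \<in> set c \<and> C.D (vtx a) (vtx (f j)) > real j" for j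
  define j where "j = (LEAST j. P j)"
  have "P n" using f ab lt n by (simp add: P_def)
  then have Pj: "P j" unfolding j_def by (rule LeastI)
  have j_least: "\<not> P i" if "i < j" for i using that not_less_Least unfolding j_def by blast
  have "j \<noteq> 0"
  proof
    assume "j = 0"
    moreover have "C.D (vtx a) (vtx a) = 0" using ab by (intro C.mdist_zero C.vtx_in)
    ultimately show False using Pj f(1) by (simp add: P_def)
  qed
  define S where "S = {i. i < j \<and> f i \<in> set c}"
  define i where "i = Max S"
  have "finite S" "S \<noteq> {}" using \<open>j \<noteq> 0\<close> f ab unfolding S_def by auto
  then have iS: "i \<in> S" and i_max: "\<And>k. k \<in> S \<Longrightarrow> k \<le> i" unfolding i_def by auto
  have ij: "i < j" "j \<le> n" "f i \<in> set c" "f j \<in> set c" using iS Pj by (auto simp: S_def P_def)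
  have Di: "C.D (vtx a) (vtx (f i)) \<le> real i"
    using j_least[of i] ij by (auto simp: P_def)
  have "C.D (vtx a) (vtx (f j)) \<le> C.D (vtx a) (vtx (f i)) + C.D (vtx (f i)) (vtx (f j))"
    using ij ab by (intro C.triangle) auto
  then have gap: "C.D (vtx (f i)) (vtx (f j)) > real j - real i"
    using Pj Di by (auto simp: P_def)
  let ?\<sigma> = "map f [i..<Suc j]"
  have ends: "hd ?\<sigma> = f i" "last ?\<sigma> = f j"
    using ij by (simp_all add: hd_map last_map)
  have len: "walk_length ?\<sigma> = j - i" using ij by (simp add: walk_length_def)
  have set\<sigma>: "set ?\<sigma> = f ` {i..j}" using ij by (auto simp: image_iff simp del: upt_Suc)
  have E\<sigma>: "walk_edges ?\<sigma> = {{f k, f (Suc k)} |k. i \<le> k \<and> k < j}" by (rule walk_edges_map_upt)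
  have sub: "walk_edges ?\<sigma> \<subseteq> E" using f ij unfolding E\<sigma> edge_walk_def by auto
  have "distinct ?\<sigma>" using inj ij unfolding distinct_map by (auto intro!: inj_onI simp del: upt_Suc)
  then have path: "vpath V E ?\<sigma>"
    using fV ij sub unfolding vpath_def set\<sigma> by auto
  have visit: "k = i \<or> k = j" if "i \<le> k" "k \<le> j" "f k \<in> set c" for k
    using i_max[of k] that by (cases "k = j") (auto simp: S_def)
  have "walk_edges ?\<sigma> \<inter> walk_edges c = {}"
  proof (rule ccontr)
    assume "walk_edges ?\<sigma> \<inter> walk_edges c \<noteq> {}"
    then obtain k where k: "i \<le> k" "k < j" "{f k, f (Suc k)} \<in> walk_edges c"
      unfolding E\<sigma> by blast
    then have "k = i" "Suc k = j"
      using visit[of k] visit[of "Suc k"] C.edge_vertices(1,2)[OF k(3)] by auto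
    then show False using C.D_edge[OF k(3), of 0 1] gap by auto
  qed
  moreover have "ugraph (set ?\<sigma>) (walk_edges ?\<sigma>)"
    unfolding ugraph_def
  proof
    fix e assume e: "e \<in> walk_edges ?\<sigma>"
    then have "card e = 2" using sub conn unfolding connected_ugraph_def ugraph_def by blast
    moreover have "e \<subseteq> set ?\<sigma>" using e unfolding E\<sigma> set\<sigma> by auto
    ultimately show "e \<subseteq> set ?\<sigma> \<and> card e = 2" by blast
  qed
  ultimately have "walk_points ?\<sigma> \<inter> walk_points c = vtx ` (set ?\<sigma> \<inter> set c)"
    unfolding walk_points_def by (intro gpoints_Int_of_disjoint_edges ugraph_c)
  also have "set ?\<sigma> \<inter> set c = {f i, f j}"
  proof
    show "set ?\<sigma> \<inter> set c \<subseteq> {f i, f j}" unfolding set\<sigma> using visit by fastforce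
  qed (use ij in \<open>auto simp: set\<sigma> simp del: upt_Suc\<close>)
  finally have "strict_shortcut V E c ?\<sigma>"
    unfolding strict_shortcut_def shortcut_def walk_dist_def ends len
    using path gap ij by (auto simp: of_nat_diff)
  moreover have "real (walk_length ?\<sigma>) \<le> D (vtx a) (vtx b)" using len ij n by simp
  moreover have "C.D (vtx a) (vtx (hd ?\<sigma>)) \<le> D (vtx a) (vtx b)" using Di ij n ends by simp
  ultimately show ?thesis using that by blast
qed

text \<open>
  The distance \<open>2 * N\<close> from \<open>a\<close> to \<open>b\<close> along the cycle is the length of the arc through \<open>p\<close>, since the
  other arc has length at least \<open>2 * N\<close> when \<open>4 * N \<le> L\<close>.  A point of the other arc in the ball of
  radius \<open>\<Delta>\<close> around \<open>p\<close> is within distance 1 of a vertex of this arc; this vertex is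
  nearer than \<open>N\<close> to \<open>p\<close> in the graph, but not along the cycle.
\<close>

lemma bottleneck_imp_shortcut_near:
  assumes \<Delta>: "\<forall>x\<in>X. \<forall>y\<in>X. \<forall>z\<in>X. x \<noteq> y \<and> D x z = D x y / 2 \<and> D z y = D x y / 2 \<longrightarrow>
      (\<forall>g. simple_path_from_to X D x y g \<longrightarrow> g ` {0..1} \<inter> mcball z \<Delta> \<noteq> {})"
    and N: "\<Delta> + 1 < real N" and L: "4 * N \<le> L" and N0: "0 < N" and p: "p \<in> set c"
  obtains \<sigma> where "strict_shortcut V E c \<sigma>" "walk_length \<sigma> \<le> 2 * N"
    "C.D (vtx p) (vtx (hd \<sigma>)) \<le> 3 * real N"
proof -
  from p obtain i where i: "p = cyc i" by (auto simp: set_c)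
  \<comment> \<open>Adding a full turn keeps the index of \<open>a\<close>, which lies \<open>N\<close> steps before \<open>p\<close>, nonnegative.\<close>
  define q where "q = i + (L - N)"
  have pq: "p = cyc (q + N)" using i L by (simp add: q_def)
  define a where "a = cyc q"
  define b where "b = cyc (q + 2 * N)"
  have C_ab: "real (2 * N) \<le> C.D (vtx a) (vtx b)"
    using C_ge[of "2 * N" q] L unfolding a_def b_def by simp
  have C_ap: "C.D (vtx a) (vtx p) \<le> N" unfolding a_def pq by (rule C_le)
  have C_pb: "C.D (vtx p) (vtx b) \<le> N"
    using C_le[of "q + N" N] unfolding b_def pq by (simp add: add.assoc mult_2)
  have in_c: "a \<in> set c" "b \<in> set c" "p \<in> set c" unfolding a_def b_def pq by auto
  then have in_X: "vtx a \<in> X" "vtx b \<in> X" "vtx p \<in> X" using c_subset by auto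
  have D_ab: "D (vtx a) (vtx b) \<le> real (2 * N)"
    using triangle[OF in_X(1,3,2)] D_le_C[OF in_c(1,3)] D_le_C[OF in_c(3,2)] C_ap C_pb by simp
  show ?thesis
  proof (cases "D (vtx a) (vtx b) < real (2 * N)")
    case True
    then have "D (vtx a) (vtx b) < C.D (vtx a) (vtx b)" using C_ab by simp
    from strict_shortcut_near[OF in_c(1,2) this] obtain \<sigma> where
      \<sigma>: "strict_shortcut V E c \<sigma>" "walk_length \<sigma> \<le> D (vtx a) (vtx b)"
        "C.D (vtx a) (vtx (hd \<sigma>)) \<le> D (vtx a) (vtx b)" by blast
    have "hd \<sigma> \<in> set c" using \<sigma>(1) by (simp add: strict_shortcut_def shortcut_def)
    then have "C.D (vtx p) (vtx (hd \<sigma>)) \<le> C.D (vtx p) (vtx a) + C.D (vtx a) (vtx (hd \<sigma>))"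
      using in_c by (intro C.triangle) auto
    then have "C.D (vtx p) (vtx (hd \<sigma>)) \<le> 3 * real N"
      using \<sigma> D_ab C_ap C.commute[of "vtx p" "vtx a"] by simp
    moreover have "real (walk_length \<sigma>) \<le> real (2 * N)" using \<sigma>(2) D_ab by linarith
    ultimately show ?thesis using that[OF \<sigma>(1)] by (simp only: of_nat_le_iff)
  next
    case False
    then have eq: "D (vtx a) (vtx b) = real (2 * N)" using D_ab by simp
    have half: "D (vtx a) (vtx p) = N" "D (vtx p) (vtx b) = N"
      using triangle[OF in_X(1,3,2)] D_le_C[OF in_c(1,3)] D_le_C[OF in_c(3,2)] C_ap C_pb eq by auto
    \<comment> \<open>\<open>h\<close> runs along the complementary arc from \<open>b\<close> to \<open>a\<close>.\<close>
    define h where "h k = cyc (q + 2 * N + k)" for k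
    define n where "n = L - 2 * N"
    have walk: "edge_walk E h n"
      using edge_walk_cyc[of "q + 2 * N" n] c_subset unfolding edge_walk_def h_def by auto
    have inj: "inj_on h {..n}"
      using N0 L cyc_shift_eq_iff[of _ _ "q + 2 * N"] unfolding h_def n_def by (intro inj_onI) auto
    have h0: "h 0 = b" "h 0 \<in> V" by (auto simp: h_def b_def)
    have "q + 2 * N + n = q + L" using L by (simp add: n_def)
    then have hn: "h n = a" unfolding h_def a_def by (simp only: cyc_add_L)
    have n0: "0 < n" using L N0 by (simp add: n_def)
    from simple_path_edge_walk[OF walk h0(2) inj n0]
    have "simple_path_from_to X D (vtx b) (vtx a) (\<lambda>t. walk_pt h (real n * t))"
      by (simp add: h0 hn)
    moreover have "vtx b \<noteq> vtx a" using eq half N0 in_X by (auto simp del: vtx_inject)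
    moreover have "D (vtx b) (vtx p) = D (vtx b) (vtx a) / 2" "D (vtx p) (vtx a) = D (vtx b) (vtx a) / 2"
      using eq half by (auto simp: commute)
    ultimately have "(\<lambda>t. walk_pt h (real n * t)) ` {0..1} \<inter> mcball (vtx p) \<Delta> \<noteq> {}"
      using \<Delta> in_X by blast
    then obtain t where t: "t \<in> {0..1}" "walk_pt h (real n * t) \<in> mcball (vtx p) \<Delta>" by blast
    then have t': "D (vtx p) (walk_pt h (real n * t)) \<le> \<Delta>" by simp
    have range: "0 \<le> real n * t" "real n * t \<le> real n" using t by (auto simp: mult_left_le)
    obtain k where k: "k < n" "real k \<le> real n * t" "real n * t \<le> real k + 1"
      using real_in_cell[OF range n0] by blast
    have "D (walk_pt h (real n * t)) (walk_pt h (real k)) \<le> \<bar>real n * t - real k\<bar>"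
      using range k by (intro D_walk_pt[OF walk h0(2)]) auto
    also have "\<dots> \<le> 1" using k by linarith
    finally have near: "D (walk_pt h (real n * t)) (vtx (h k)) \<le> 1" by simp
    have "D (vtx p) (vtx (h k)) \<le> D (vtx p) (walk_pt h (real n * t)) + D (walk_pt h (real n * t)) (vtx (h k))"
      using in_X(3) walk_pt_in[OF walk h0(2) range] by (intro triangle) (simp_all add: h_def[of k])
    then have D_pw: "D (vtx p) (vtx (h k)) < N" using near t' N by linarith
    have "real (min (N + k) (L - (N + k))) \<le> C.D (vtx p) (vtx (cyc (q + N + (N + k))))"
      unfolding pq using k L by (intro C_ge) (simp add: n_def)
    moreover have "cyc (q + N + (N + k)) = h k" by (simp add: h_def mult_2 add.assoc)
    moreover have "N \<le> min (N + k) (L - (N + k))" using k L by (simp add: n_def)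
    ultimately have "real N \<le> C.D (vtx p) (vtx (h k))" by (smt (verit) of_nat_mono)
    with D_pw have "D (vtx p) (vtx (h k)) < C.D (vtx p) (vtx (h k))" by simp
    moreover have "h k \<in> set c" by (simp add: h_def)
    ultimately obtain \<sigma> where
      \<sigma>: "strict_shortcut V E c \<sigma>" "walk_length \<sigma> \<le> D (vtx p) (vtx (h k))"
        "C.D (vtx p) (vtx (hd \<sigma>)) \<le> D (vtx p) (vtx (h k))"
      using strict_shortcut_near[OF in_c(3)] by blast
    then have "real (walk_length \<sigma>) \<le> real (2 * N)" "C.D (vtx p) (vtx (hd \<sigma>)) \<le> 3 * real N"
      using D_pw by auto
    then show ?thesis using that[OF \<sigma>(1)] by (simp only: of_nat_le_iff)
  qed
qed

end

section \<open>The Bottleneck Property implies dense chordality\<close>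

context connected_graph
begin

text \<open>
  Every vertex of a long cycle has a shortcut vertex within distance \<open>3 * N\<close>, and every other
  point of the cycle has a vertex within distance 1.
\<close>

lemma bottleneck_imp_densely_chordal:
  assumes "bottleneck_property X D"
  shows "\<exists>\<epsilon>>0. \<exists>k m :: nat. k \<ge> 4 \<and> k \<ge> 2 * m \<and> densely_chordal V E \<epsilon> k m"
proof -
  obtain \<Delta> where \<Delta>: "\<Delta> > 0"
    "\<forall>x\<in>X. \<forall>y\<in>X. \<forall>z\<in>X. x \<noteq> y \<and> D x z = D x y / 2 \<and> D z y = D x y / 2 \<longrightarrow>
      (\<forall>g. simple_path_from_to X D x y g \<longrightarrow> g ` {0..1} \<inter> mcball z \<Delta> \<noteq> {})"
    using assms unfolding bottleneck_property_def by (elim exE conjE)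
  obtain N :: nat where N: "\<Delta> + 1 < real N" using reals_Archimedean2 by blast
  have "0 < N" using N \<Delta>(1) by (cases N) auto
  have "densely_chordal V E (3 * real N + 2) (4 * N) (2 * N)"
    unfolding densely_chordal_def
  proof (intro allI impI, elim conjE)
    fix c assume c: "vcycle V E c" "4 * N \<le> walk_length c"
    interpret cycle_in_graph V E c by unfold_locales (rule c)
    have "\<exists>\<sigma>. strict_shortcut V E c \<sigma> \<and> walk_length \<sigma> \<le> 2 * N \<and>
        C.D (vtx p) (vtx (hd \<sigma>)) \<le> 3 * real N" if "p \<in> set c" for p
    proof -
      have "4 * N \<le> L" using c by (simp add: L_def)
      from bottleneck_imp_shortcut_near[OF \<Delta>(2) N this \<open>0 < N\<close> that] show ?thesis by blast
    qed
    then obtain s where s: "\<And>p. p \<in> set c \<Longrightarrow> strict_shortcut V E c (s p)"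
        "\<And>p. p \<in> set c \<Longrightarrow> walk_length (s p) \<le> 2 * N"
        "\<And>p. p \<in> set c \<Longrightarrow> C.D (vtx p) (vtx (hd (s p))) \<le> 3 * real N" by metis
    have ends: "hd (s p) \<in> set c" "last (s p) \<in> set c" if "p \<in> set c" for p
      using s(1)[OF that] by (auto simp: strict_shortcut_def shortcut_def)
    let ?A = "vtx ` (\<Union>\<sigma>\<in>set (map s c). shortcut_vertices \<sigma>)"
    have "eps_dense (3 * real N + 2) (walk_points c) (walk_dist c) ?A"
      unfolding eps_dense_def walk_points_def walk_dist_def
    proof (intro conjI ballI)
      show "?A \<subseteq> gpoints (set c) (walk_edges c)" using ends by (auto simp: shortcut_vertices_def)
      fix x assume x: "x \<in> gpoints (set c) (walk_edges c)"
      obtain p where p: "p \<in> set c" "C.D x (vtx p) \<le> 1" using C.near_vertex[OF x] by blast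
      have "C.D x (vtx (hd (s p))) \<le> C.D x (vtx p) + C.D (vtx p) (vtx (hd (s p)))"
        using x p ends by (intro C.triangle) auto
      then have "C.D (vtx (hd (s p))) x < 3 * real N + 2"
        using p(2) s(3)[OF p(1)] C.commute[of x "vtx (hd (s p))"] by linarith
      moreover have "vtx (hd (s p)) \<in> ?A" using p by (auto simp: shortcut_vertices_def)
      ultimately show "\<exists>a\<in>?A. C.D a x < 3 * real N + 2" by blast
    qed
    then show "\<exists>\<sigma>s. (\<forall>\<sigma>\<in>set \<sigma>s. strict_shortcut V E c \<sigma> \<and> walk_length \<sigma> \<le> 2 * N) \<and>
        eps_dense (3 * real N + 2) (walk_points c) (walk_dist c)
          (vtx ` (\<Union>\<sigma>\<in>set \<sigma>s. shortcut_vertices \<sigma>))"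
      using s(1,2) by (intro exI[of _ "map s c"]) simp
  qed
  moreover have "3 * real N + 2 > 0" "4 * N \<ge> 4" "4 * N \<ge> 2 * (2 * N)" using \<open>0 < N\<close> by auto
  ultimately show ?thesis by blast
qed

end

section \<open>Dense chordality implies the Bottleneck Property\<close>

context connected_graph
begin

definition far_adj :: "'a \<Rightarrow> nat \<Rightarrow> ('a \<times> 'a) set" where
  "far_adj w \<rho> = {(u, v) \<in> adj E. D (vtx w) (vtx u) > real \<rho> \<and> D (vtx w) (vtx v) > real \<rho>}"

lemma sym_far_adj: "sym (far_adj w \<rho>)"
  by (auto simp: far_adj_def adj_def sym_def insert_commute)

lemma far_adj_close:
  assumes "w \<in> V" "u \<in> V" "v \<in> V" "D (vtx u) (vtx v) \<le> r" "D (vtx w) (vtx u) > real \<rho> + r"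
  shows "(u, v) \<in> (far_adj w \<rho>)\<^sup>*"
proof -
  obtain n f where f: "f 0 = u" "f n = v" "edge_walk E f n" "D (vtx u) (vtx v) = real n"
    using D_eq_shortest_walk[OF assms(2,3)] unfolding relpow_adj_iff by blast
  have "D (vtx w) (vtx (f k)) > real \<rho>" if "k \<le> n" for k
  proof -
    have "f k \<in> V" using edge_walk_in[OF f(3)] f assms that by simp
    then have "D (vtx w) (vtx u) \<le> D (vtx w) (vtx (f k)) + D (vtx (f k)) (vtx u)"
      using assms by (intro triangle) auto
    moreover have "D (vtx (f k)) (vtx u) \<le> real k"
      using D_edge_walk[OF f(3), of k 0] f assms that by simp
    ultimately show ?thesis using that f assms by linarith
  qed
  then have "(f k, f (Suc k)) \<in> far_adj w \<rho>" if "k < n" for k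
    using that f(3) by (auto simp: far_adj_def adj_def edge_walk_def)
  then have "(u, v) \<in> far_adj w \<rho> ^^ n" unfolding relpow_fun_conv using f by blast
  then show ?thesis by (rule relpow_imp_rtrancl)
qed

text \<open>
  Assign to each time \<open>t\<close> a vertex \<open>N t\<close> next to \<open>g t\<close>.  For neighbouring times these vertices
  have distance at most 3, so that geodesics between them stay away from \<open>w\<close> as well; hence being joined by a
  walk far from \<open>w\<close> is locally constant in \<open>t\<close>, and the interval is connected.
\<close>

lemma path_far_adj:
  assumes g: "pathin mtopology g" and w: "w \<in> V"
    and far: "\<And>t. t \<in> {0..1} \<Longrightarrow> D (vtx w) (g t) > real \<rho> + 4"
    and u: "u \<in> V" "D (vtx u) (g 0) \<le> 1" and v: "v \<in> V" "D (vtx v) (g 1) \<le> 1"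
  shows "(u, v) \<in> (far_adj w \<rho>)\<^sup>*"
proof -
  have cont: "continuous_map (top_of_set {0..1}) mtopology g" using g by (simp add: pathin_def)
  have gX: "g t \<in> X" if "t \<in> {0..1}" for t
    using continuous_map_image_subset_topspace[OF cont] that by auto
  have "\<exists>N. \<forall>t\<in>{0..1}. N t \<in> V \<and> D (g t) (vtx (N t)) \<le> 1"
    using near_vertex[OF gX] by (intro bchoice ballI) blast
  then obtain N where N: "\<And>t. t \<in> {0..1} \<Longrightarrow> N t \<in> V" "\<And>t. t \<in> {0..1} \<Longrightarrow> D (g t) (vtx (N t)) \<le> 1"
    by blast
  have close: "(a, b) \<in> (far_adj w \<rho>)\<^sup>*"
    if "s \<in> {0..1}" "t \<in> {0..1}" "D (g s) (g t) \<le> 1" "a \<in> V" "b \<in> V"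
      "D (g s) (vtx a) \<le> 1" "D (g t) (vtx b) \<le> 1" for s t a b
  proof (rule far_adj_close[where r = 3])
    have X: "g s \<in> X" "g t \<in> X" "vtx a \<in> X" "vtx b \<in> X" using gX that by auto
    show "D (vtx a) (vtx b) \<le> 3"
      using triangle[OF X(3,1,4)] triangle[OF X(1,2,4)] that commute[of "vtx a" "g s"] by linarith
    show "D (vtx w) (vtx a) > real \<rho> + 3"
      using triangle[of "vtx w" "vtx a" "g s"] X w far[OF that(1)] that commute[of "vtx a" "g s"] by simp
  qed (use w that in auto)
  have "(N 0, N 1) \<in> (far_adj w \<rho>)\<^sup>*"
  proof (rule connected_equivalence_relation[of "{0..1::real}" 0 1 "\<lambda>s t. (N s, N t) \<in> (far_adj w \<rho>)\<^sup>*"])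
    fix s :: real assume s: "s \<in> {0..1}"
    then obtain U where U: "openin (top_of_set {0..1}) U" "s \<in> U" "\<forall>t\<in>U. g t \<in> mball (g s) 1"
      using cont unfolding continuous_map_to_metric by (metis topspace_euclidean_subtopology zero_less_one)
    have "(N s, N t) \<in> (far_adj w \<rho>)\<^sup>*" if "t \<in> U" for t
      using U that N s openin_imp_subset[OF U(1)] by (intro close[of s t]) auto
    with U show "\<exists>T. openin (top_of_set {0..1}) T \<and> s \<in> T \<and> (\<forall>t\<in>T. (N s, N t) \<in> (far_adj w \<rho>)\<^sup>*)"
      by blast
  next
    fix s t :: real assume "(N s, N t) \<in> (far_adj w \<rho>)\<^sup>*"
    then show "(N t, N s) \<in> (far_adj w \<rho>)\<^sup>*" using sym_rtrancl[OF sym_far_adj] by (auto dest: symD)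
  qed (auto intro: rtrancl_trans)
  moreover have "(u, N 0) \<in> (far_adj w \<rho>)\<^sup>*"
    using u N gX[of 0] by (intro close[of 0 0]) (auto simp: commute)
  moreover have "(N 1, v) \<in> (far_adj w \<rho>)\<^sup>*"
    using v N gX[of 1] by (intro close[of 1 1]) (auto simp: commute)
  ultimately show ?thesis by (meson rtrancl_trans)
qed

text \<open>
  The detour is chosen as a shortest one among all walks through far vertices that lead from the part
  of \<open>\<gamma>\<close> before the ball around \<open>\<gamma> s\<close> to the part behind it.  By minimality it repeats no vertex and
  meets \<open>\<gamma>\<close> only in its ends, so together with the segment of \<open>\<gamma>\<close> between its ends it is a cycle.
\<close>

lemma far_detour_cycle:
  assumes \<gamma>: "edge_walk E \<gamma> n" "\<gamma> 0 \<in> V"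
      "\<And>i j. i \<le> n \<Longrightarrow> j \<le> n \<Longrightarrow> D (vtx (\<gamma> i)) (vtx (\<gamma> j)) = \<bar>real i - real j\<bar>"
    and s: "\<rho> < s" "s + \<rho> < n" and \<rho>: "2 \<le> \<rho>"
    and detour: "(\<gamma> 0, \<gamma> n) \<in> (far_adj (\<gamma> s) \<rho>)\<^sup>*"
  obtains c i j where "vcycle V E c" "2 * \<rho> \<le> walk_length c" "i \<le> s" "s \<le> j" "j \<le> n"
    "\<gamma> ` {i..j} \<subseteq> set c" "\<And>k. i \<le> k \<Longrightarrow> k < j \<Longrightarrow> {\<gamma> k, \<gamma> (Suc k)} \<in> walk_edges c"
    "\<And>v. v \<in> set c \<Longrightarrow> D (vtx (\<gamma> s)) (vtx v) \<le> real \<rho> \<Longrightarrow> v \<in> \<gamma> ` {i..j}"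
proof -
  let ?R = "far_adj (\<gamma> s) \<rho>"
  define P where "P m \<longleftrightarrow> (\<exists>i j. i + \<rho> < s \<and> s + \<rho> < j \<and> j \<le> n \<and> (\<gamma> i, \<gamma> j) \<in> ?R ^^ m)" for m
  define m where "m = (LEAST m. P m)"
  have "\<exists>m. P m" using detour s unfolding P_def rtrancl_power by force
  then have "P m" unfolding m_def by (rule LeastI_ex)
  have m_least: "m \<le> m'" if "P m'" for m' using that unfolding m_def by (rule Least_le)
  from \<open>P m\<close> obtain i j where ij: "i + \<rho> < s" "s + \<rho> < j" "j \<le> n" and "(\<gamma> i, \<gamma> j) \<in> ?R ^^ m"
    unfolding P_def by blast
  then obtain f where f: "f 0 = \<gamma> i" "f m = \<gamma> j" "\<And>k. k < m \<Longrightarrow> (f k, f (Suc k)) \<in> ?R"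
    unfolding relpow_fun_conv by blast
  have \<gamma>_inj: "k = l" if "\<gamma> k = \<gamma> l" "k \<le> n" "l \<le> n" for k l
    using \<gamma>(3)[of k l] \<gamma>(3)[of k k] that by simp
  have \<gamma>V: "\<gamma> k \<in> V" if "k \<le> n" for k using edge_walk_in[OF \<gamma>(1,2) that] .
  have "m \<noteq> 0"
  proof
    assume "m = 0"
    then have "i = j" using f ij \<gamma>_inj[of i j] by simp
    with ij show False by simp
  qed
  have f_far: "D (vtx (\<gamma> s)) (vtx (f k)) > real \<rho>" if "k \<le> m" for k
  proof (cases "k = m")
    case True
    then show ?thesis using f(3)[of "m - 1"] \<open>m \<noteq> 0\<close> by (auto simp: far_adj_def)
  next
    case False
    then show ?thesis using f(3)[of k] that by (auto simp: far_adj_def)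
  qed
  have f_edge: "{f k, f (Suc k)} \<in> E" if "k < m" for k
    using f(3)[OF that] by (auto simp: far_adj_def adj_def)
  have fV: "f k \<in> V" if "k \<le> m" for k
    using edge_walk_in[of f m k] f_edge that f(1) \<gamma>V[of i] ij by (simp add: edge_walk_def)
  have sub: "(f k, f l) \<in> ?R ^^ (l - k)" if "k \<le> l" "l \<le> m" for k l
    unfolding relpow_fun_conv using that f(3) by (intro exI[of _ "\<lambda>r. f (k + r)"]) auto
  have f_inj: "k = l" if "f k = f l" "k \<le> m" "l \<le> m" for k l
  proof -
    have "\<not> k < l" if "f k = f l" "k \<le> m" "l \<le> m" for k l
    proof
      assume "k < l"
      have "(f 0, f k) \<in> ?R ^^ k" "(f k, f m) \<in> ?R ^^ (m - l)"
        using sub[of 0 k] sub[of l m] that by auto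
      then have "(\<gamma> i, \<gamma> j) \<in> ?R ^^ (k + (m - l))" unfolding relpow_add f by auto
      then have "P (k + (m - l))" unfolding P_def using ij by blast
      from m_least[OF this] show False using \<open>k < l\<close> that by simp
    qed
    then show ?thesis using that by (metis nat_neq_iff)
  qed
  have off: "f k \<noteq> \<gamma> l" if "0 < k" "k < m" "l \<le> n" for k l
  proof
    assume eq: "f k = \<gamma> l"
    have "\<bar>real s - real l\<bar> > real \<rho>" using f_far[of k] eq \<gamma>(3)[of s l] that s by simp
    then consider "l + \<rho> < s" | "s + \<rho> < l" by linarith
    then show False
    proof cases
      case 1
      have "(\<gamma> l, \<gamma> j) \<in> ?R ^^ (m - k)" using sub[of k m] that eq f by simp
      then have "P (m - k)" unfolding P_def using 1 ij by blast
      from m_least[OF this] show False using that by simp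
    next
      case 2
      have "(\<gamma> i, \<gamma> l) \<in> ?R ^^ k" using sub[of 0 k] that eq f by simp
      then have "P k" unfolding P_def using 2 ij that by blast
      from m_least[OF this] show False using that by simp
    qed
  qed
  \<comment> \<open>The cycle follows \<open>\<gamma>\<close> from \<open>\<gamma> i\<close> to \<open>\<gamma> j\<close> and returns along the detour.\<close>
  define h where "h k = (if k \<le> j - i then \<gamma> (i + k) else f (m - (k - (j - i))))" for k
  define l where "l = j - i + m"
  let ?c = "map h [0..<Suc l]"
  have h_ends: "h 0 = \<gamma> i" "h l = \<gamma> i" using \<open>m \<noteq> 0\<close> f by (auto simp: h_def l_def)
  have h_edge: "{h k, h (Suc k)} \<in> E" if "k < l" for k
  proof -
    consider "k < j - i" | "k = j - i" | "j - i < k" by linarith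
    then show ?thesis
    proof cases
      case 1
      then show ?thesis using \<gamma>(1) ij by (auto simp: h_def edge_walk_def)
    next
      case 2
      then show ?thesis using f_edge[of "m - 1"] f(2) \<open>m \<noteq> 0\<close> ij by (simp add: h_def insert_commute)
    next
      case 3
      then have "Suc (m - (Suc k - (j - i))) = m - (k - (j - i))" using that by (simp add: l_def)
      then show ?thesis using f_edge[of "m - (Suc k - (j - i))"] 3 that \<open>m \<noteq> 0\<close>
        by (simp add: h_def insert_commute)
    qed
  qed
  have hV: "h k \<in> V" if "k \<le> l" for k
    using \<gamma>V fV ij that by (auto simp: h_def)
  have h_inj: "inj_on h {1..l}"
  proof (rule inj_onI)
    have mixed: "\<gamma> (i + k) \<noteq> f (m - (k' - (j - i)))"
      if "1 \<le> k" "k \<le> j - i" "j - i < k'" "k' \<le> l" for k k'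
    proof (cases "k' = l")
      case True
      moreover have "i + k \<le> n" using that(2) ij by linarith
      ultimately show ?thesis using \<gamma>_inj[of "i + k" i] f(1) that ij by (auto simp: l_def)
    next
      case False
      then have "0 < m - (k' - (j - i))" "m - (k' - (j - i)) < m" "i + k \<le> n"
        using that ij unfolding l_def by linarith+
      from off[OF this] show ?thesis by (rule not_sym)
    qed
    fix k k' assume k: "k \<in> {1..l}" "k' \<in> {1..l}" and eq: "h k = h k'"
    consider "k \<le> j - i" "k' \<le> j - i" | "k \<le> j - i" "j - i < k'" | "j - i < k" "k' \<le> j - i"
      | "j - i < k" "j - i < k'" by linarith
    then show "k = k'"
    proof cases
      case 1
      then show ?thesis using eq \<gamma>_inj[of "i + k" "i + k'"] ij by (simp add: h_def)
    next
      case 2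
      then have "h k = \<gamma> (i + k)" "h k' = f (m - (k' - (j - i)))" unfolding h_def by auto
      then show ?thesis using eq mixed[of k k'] k 2 by (metis atLeastAtMost_iff)
    next
      case 3
      then have "h k' = \<gamma> (i + k')" "h k = f (m - (k - (j - i)))" unfolding h_def by auto
      then show ?thesis using eq mixed[of k' k] k 3 by (metis atLeastAtMost_iff)
    next
      case 4
      then have "m - (k - (j - i)) = m - (k' - (j - i))" using eq f_inj by (simp add: h_def)
      then show ?thesis using 4 k by (auto simp: l_def)
    qed
  qed
  have edges: "walk_edges ?c = {{h k, h (Suc k)} |k. 0 \<le> k \<and> k < l}" by (rule walk_edges_map_upt)
  have set: "set ?c = h ` {..l}" by (auto simp: image_iff less_Suc_eq_le simp del: upt_Suc)
  have "vcycle V E ?c"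
    unfolding vcycle_def
  proof (intro conjI)
    show "4 \<le> length ?c" using ij \<rho> by (simp add: l_def)
    have "hd ?c = h 0" by (simp add: hd_map del: upt_Suc)
    then show "hd ?c = last ?c" using h_ends by simp
    have "tl ?c = map h [1..<Suc l]" by (simp only: map_tl[symmetric] tl_upt One_nat_def)
    then show "distinct (tl ?c)" using h_inj by (simp add: distinct_map atLeastLessThanSuc_atLeastAtMost del: upt_Suc)
    show "set ?c \<subseteq> V" using hV unfolding set by auto
    show "walk_edges ?c \<subseteq> E" using h_edge unfolding edges by auto
  qed
  moreover have "2 * \<rho> \<le> walk_length ?c" using ij by (simp add: walk_length_def l_def)
  moreover have "\<gamma> ` {i..j} \<subseteq> set ?c"
  proof
    fix v assume "v \<in> \<gamma> ` {i..j}"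
    then obtain k where "k \<in> {i..j}" "v = \<gamma> k" by blast
    then show "v \<in> set ?c"
      unfolding set by (intro image_eqI[of _ _ "k - i"]) (auto simp: h_def l_def)
  qed
  moreover have "{\<gamma> k, \<gamma> (Suc k)} \<in> walk_edges ?c" if "i \<le> k" "k < j" for k
    unfolding edges using that by (intro CollectI exI[of _ "k - i"]) (auto simp: h_def l_def)
  moreover have "i \<le> s" "s \<le> j" "j \<le> n" using ij by auto
  moreover have "v \<in> \<gamma> ` {i..j}" if "v \<in> set ?c" and near: "D (vtx (\<gamma> s)) (vtx v) \<le> real \<rho>" for v
  proof -
    obtain k where k: "k \<le> l" "v = h k" using \<open>v \<in> set ?c\<close> unfolding set by blast
    have "k \<le> j - i" using near f_far[of "m - (k - (j - i))"] unfolding k by (auto simp: h_def split: if_splits)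
    then show ?thesis using k ij by (auto simp: h_def)
  qed
  ultimately show ?thesis by (intro that[of ?c i j]) assumption+
qed

text \<open>
  The cycle of \<open>far_detour_cycle\<close> would have a shortcut with one end at distance less than \<open>\<epsilon>\<close> from
  \<open>\<gamma> s\<close>, hence with both ends at distance at most \<open>\<epsilon> + m\<close> and therefore on \<open>\<gamma>\<close>.  There the cycle
  itself is a geodesic, so it has no shortcut.
\<close>

lemma densely_chordal_no_detour:
  assumes chordal: "densely_chordal V E \<epsilon> k m"
    and \<gamma>: "edge_walk E \<gamma> n" "\<gamma> 0 \<in> V" "D (vtx (\<gamma> 0)) (vtx (\<gamma> n)) = real n"
    and s: "\<rho> < s" "s + \<rho> < n" and \<rho>: "2 \<le> \<rho>" "k \<le> \<rho>" "\<epsilon> + real m \<le> real \<rho>"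
  shows "(\<gamma> 0, \<gamma> n) \<notin> (far_adj (\<gamma> s) \<rho>)\<^sup>*"
proof
  assume "(\<gamma> 0, \<gamma> n) \<in> (far_adj (\<gamma> s) \<rho>)\<^sup>*"
  from far_detour_cycle[OF \<gamma>(1,2) isometric_shortest_walk[OF \<gamma>] s \<rho>(1) this]
  obtain c i j where c: "vcycle V E c" "2 * \<rho> \<le> walk_length c"
    and ij: "i \<le> s" "s \<le> j" "j \<le> n" and sub: "\<gamma> ` {i..j} \<subseteq> set c"
    and edges: "\<And>k. i \<le> k \<Longrightarrow> k < j \<Longrightarrow> {\<gamma> k, \<gamma> (Suc k)} \<in> walk_edges c"
    and near: "\<And>v. v \<in> set c \<Longrightarrow> D (vtx (\<gamma> s)) (vtx v) \<le> real \<rho> \<Longrightarrow> v \<in> \<gamma> ` {i..j}"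
    by blast
  interpret cycle_in_graph V E c by unfold_locales (rule c)
  have "k \<le> walk_length c" using c \<rho> by simp
  with chordal c obtain \<sigma>s where \<sigma>s: "\<forall>\<sigma>\<in>set \<sigma>s. strict_shortcut V E c \<sigma> \<and> walk_length \<sigma> \<le> m"
    "eps_dense \<epsilon> (walk_points c) (walk_dist c) (vtx ` (\<Union>\<sigma>\<in>set \<sigma>s. shortcut_vertices \<sigma>))"
    unfolding densely_chordal_def by blast
  have s_c: "\<gamma> s \<in> set c" using sub ij by auto
  then have "vtx (\<gamma> s) \<in> walk_points c" by (simp add: walk_points_def)
  with \<sigma>s(2) obtain \<sigma> a where \<sigma>: "\<sigma> \<in> set \<sigma>s" "a \<in> {hd \<sigma>, last \<sigma>}" "C.D (vtx a) (vtx (\<gamma> s)) < \<epsilon>"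
    unfolding eps_dense_def walk_dist_def shortcut_vertices_def by blast
  have \<sigma>': "vpath V E \<sigma>" "hd \<sigma> \<in> set c" "last \<sigma> \<in> set c" "walk_length \<sigma> \<le> m"
    "walk_length \<sigma> < C.D (vtx (hd \<sigma>)) (vtx (last \<sigma>))"
    using \<sigma>s \<sigma>(1) by (auto simp: strict_shortcut_def shortcut_def walk_dist_def)
  have D_\<sigma>: "D (vtx (hd \<sigma>)) (vtx (last \<sigma>)) \<le> walk_length \<sigma>" by (rule D_vpath_le[OF \<sigma>'(1)])
  have "b \<in> \<gamma> ` {i..j}" if b: "b \<in> {hd \<sigma>, last \<sigma>}" for b
  proof (rule near)
    have bc: "a \<in> set c" "b \<in> set c" using b \<sigma> \<sigma>' by auto
    then have inX: "vtx a \<in> X" "vtx b \<in> X" "vtx (\<gamma> s) \<in> X" using c_subset s_c by auto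
    have "D (vtx a) (vtx b) \<le> m"
      using b \<sigma>(2) D_\<sigma> \<sigma>'(4) inX commute[of "vtx a" "vtx b"] by auto
    moreover have "D (vtx a) (vtx (\<gamma> s)) < \<epsilon>" using D_le_C[OF bc(1) s_c] \<sigma>(3) by simp
    ultimately show "D (vtx (\<gamma> s)) (vtx b) \<le> real \<rho>"
      using triangle[OF inX(3,1,2)] commute[of "vtx a" "vtx (\<gamma> s)"] \<rho>(3) by linarith
    show "b \<in> set c" by (rule bc)
  qed
  then obtain p q where pq: "hd \<sigma> = \<gamma> p" "last \<sigma> = \<gamma> q" "p \<in> {i..j}" "q \<in> {i..j}" by (meson image_iff insertCI)
  have "edge_walk (walk_edges c) (\<lambda>k. \<gamma> (i + k)) (j - i)" using edges by (auto simp: edge_walk_def)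
  from C.D_edge_walk[OF this, of "p - i" "q - i"]
  have "C.D (vtx (\<gamma> p)) (vtx (\<gamma> q)) \<le> \<bar>real p - real q\<bar>"
    using pq(3,4) sub diff_le_mono[of p j i] diff_le_mono[of q j i]
    by (auto simp: of_nat_diff image_subset_iff)
  also have "\<dots> = D (vtx (\<gamma> p)) (vtx (\<gamma> q))"
    using pq ij by (simp add: isometric_shortest_walk[OF \<gamma>])
  finally show False using D_\<sigma> \<sigma>'(5) pq by simp
qed

text \<open>
  The end points and the midpoint of the geodesic may lie inside edges.  Vertices \<open>a\<close>, \<open>b\<close>, \<open>w\<close> next to
  them are chosen on the geodesic, so that \<open>w\<close> lies on a geodesic from \<open>a\<close> to \<open>b\<close>; the additive
  constants absorb the distances lost in this way.
\<close>

lemma densely_chordal_imp_bottleneck: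
  assumes chordal: "densely_chordal V E \<epsilon> k m"
  shows "bottleneck_property X D"
proof -
  define \<rho> where "\<rho> = nat \<lceil>\<epsilon>\<rceil> + m + k + 2"
  have \<rho>: "2 \<le> \<rho>" "k \<le> \<rho>" "\<epsilon> + real m \<le> real \<rho>" unfolding \<rho>_def by linarith+
  have "g ` {0..1} \<inter> mcball z (real \<rho> + 5) \<noteq> {}"
    if X: "x \<in> X" "y \<in> X" "z \<in> X" and half: "D x z = D x y / 2" "D z y = D x y / 2"
      and g: "simple_path_from_to X D x y g" for x y z g
  proof
    assume avoid: "g ` {0..1} \<inter> mcball z (real \<rho> + 5) = {}"
    have path: "pathin mtopology g" "g 0 = x" "g 1 = y" using g by (auto simp: simple_path_from_to_def)
    then have "continuous_map (top_of_set {0..1}) mtopology g" by (simp add: pathin_def)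
    then have gX: "g t \<in> X" if "t \<in> {0..1}" for t
      using continuous_map_image_subset_topspace that by fastforce
    have g_far: "D z (g t) > real \<rho> + 5" if "t \<in> {0..1}" for t
      using avoid gX[OF that] X that by (force simp: not_le)
    have zx: "D x z > real \<rho> + 5" "D y z > real \<rho> + 5"
      using g_far[of 0] g_far[of 1] path by (auto simp: commute)
    obtain a where a: "a \<in> V" "D x (vtx a) \<le> 1" "D x z = D x (vtx a) + D (vtx a) z"
      using exit_vertex[OF X(1,3)] zx by (smt (verit) of_nat_0_le_iff)
    obtain b where b: "b \<in> V" "D y (vtx b) \<le> 1" "D y z = D y (vtx b) + D (vtx b) z"
      using exit_vertex[OF X(2,3)] zx by (smt (verit) of_nat_0_le_iff)
    have inX: "vtx a \<in> X" "vtx b \<in> X" using a b by auto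
    have "D z (vtx a) > 1" using a zx commute[of z "vtx a"] by linarith
    then obtain w where w: "w \<in> V" "D z (vtx w) \<le> 1" "D z (vtx a) = D z (vtx w) + D (vtx w) (vtx a)"
      using exit_vertex[OF X(3) inX(1)] by blast
    have wX: "vtx w \<in> X" using w by simp
    \<comment> \<open>As \<open>z\<close> is a midpoint, the ways from \<open>a\<close> and from \<open>b\<close> to \<open>z\<close> add up to a geodesic, and \<open>w\<close> is on the first one.\<close>
    have "D x y \<le> D x (vtx a) + D (vtx a) (vtx b) + D (vtx b) y"
      using triangle[OF X(1) inX(1) X(2)] triangle[OF inX X(2)] by linarith
    then have "D (vtx a) (vtx w) + D (vtx w) (vtx b) \<le> D (vtx a) (vtx b)"
      using a b w half triangle[OF wX X(3) inX(2)] commute[of z "vtx a"] commute[of "vtx w" z]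
        commute[of "vtx w" "vtx a"] commute[of y z] commute[of y "vtx b"] commute[of "vtx b" z] by linarith
    then have ab: "D (vtx a) (vtx b) = D (vtx a) (vtx w) + D (vtx w) (vtx b)"
      using triangle[OF inX(1) wX inX(2)] by linarith
    obtain n1 f1 where f1: "f1 0 = a" "f1 n1 = w" "edge_walk E f1 n1" "D (vtx a) (vtx w) = real n1"
      using D_eq_shortest_walk[OF a(1) w(1)] unfolding relpow_adj_iff by blast
    obtain n2 f2 where f2: "f2 0 = w" "f2 n2 = b" "edge_walk E f2 n2" "D (vtx w) (vtx b) = real n2"
      using D_eq_shortest_walk[OF w(1) b(1)] unfolding relpow_adj_iff by blast
    define \<gamma> where "\<gamma> k = (if k \<le> n1 then f1 k else f2 (k - n1))" for k
    have \<gamma>_ends: "\<gamma> 0 = a" "\<gamma> n1 = w" "\<gamma> (n1 + n2) = b" using f1 f2 by (auto simp: \<gamma>_def)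
    have "edge_walk E \<gamma> (n1 + n2)"
      unfolding edge_walk_def
    proof (intro allI impI)
      fix k assume k: "k < n1 + n2"
      consider "k < n1" | "k = n1" | "n1 < k" by linarith
      then show "{\<gamma> k, \<gamma> (Suc k)} \<in> E"
        using f1 f2 k by cases (auto simp: \<gamma>_def edge_walk_def Suc_diff_le)
    qed
    moreover have "D (vtx (\<gamma> 0)) (vtx (\<gamma> (n1 + n2))) = real (n1 + n2)"
      using ab f1 f2 \<gamma>_ends by simp
    moreover have "\<rho> < n1"
      using f1(4) w a zx commute[of z "vtx a"] commute[of "vtx w" "vtx a"] by linarith
    moreover have "real n2 > real \<rho>"
      using f2(4) b w zx triangle[OF inX(2) wX X(3)] commute[of "vtx b" "vtx w"] commute[of "vtx w" z] by linarith
    ultimately have "(a, b) \<notin> (far_adj w \<rho>)\<^sup>*"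
      using densely_chordal_no_detour[OF chordal, of \<gamma> "n1 + n2" \<rho> n1] \<gamma>_ends a \<rho> by simp
    moreover have "(a, b) \<in> (far_adj w \<rho>)\<^sup>*"
    proof (rule path_far_adj[OF path(1)])
      fix t :: real assume t: "t \<in> {0..1}"
      show "D (vtx w) (g t) > real \<rho> + 4"
        using g_far[OF t] triangle[OF X(3) wX gX[OF t]] w by linarith
    qed (use a b w path in \<open>auto simp: commute\<close>)
    ultimately show False by blast
  qed
  then show ?thesis unfolding bottleneck_property_def
    by (intro exI[of _ "real \<rho> + 5"] conjI) auto
qed

end

theorem theorem3p6:
  fixes V :: "'a set" and E :: "'a set set"
  assumes "connected_ugraph V E"
  shows "bottleneck_property (gpoints V E) (gdist V E) \<longleftrightarrow>
    (\<exists>\<epsilon>>0. \<exists>k m :: nat. k \<ge> 4 \<and> k \<ge> 2 * m \<and> densely_chordal V E \<epsilon> k m)"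
proof -
  interpret connected_graph V E by unfold_locales (rule assms)
  show ?thesis using bottleneck_imp_densely_chordal densely_chordal_imp_bottleneck by blast
qed

end
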